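(* Let $P\subset\mathbb R^d$ be a rational $d$-polytope with $-P=P+\bm u$ for some $\bm u\in\mathbb Z^d$, and let $C$ be a $d$-dimensional cell of $\Delta_P/\mathbb Z^d$. For $k\in\mathbb Z$, let $f(t)$ be the $k$th constituent and $g(t)$ the $(-k)$th constituent of the quasi-polynomial $\mathrm{TL}_{P,C}$. Then $f(t)=(-1)^d g(-t)$.
   Context: $P=\bigcap_{i=1}^m\{\bm x:(\bm a_i,\bm x)\ge b_i\}$ irredundantly, $(\bm a_i,b_i)\in\mathbb Z^{d+1}$ primitive; $\Delta_P$ is the decomposition of $\mathbb R^d$ into open cells by the hyperplanes $(\bm a_i,\bm x)=k$ ($k\in\mathbb Z$), and $\Delta_P/\mathbb Z^d$ its image in $\mathbb R^d/\mathbb Z^d$. $\mathrm{TL}_{P,C}:=\mathrm{TL}_{P,\bm v}$ for any $\bm v$ with $[\bm v]\in C$, where $\mathrm{TL}_{P,\bm v}(t)=\#((tP+\bm v)\cap\mathbb Z^d)$, a quasi-polynomial. The $k$th constituent for $k\in\mathbb Z$ is the polynomial agreeing with it on $t\equiv k$ modulo a period. *)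

theory Defs
  imports "HOL-Analysis.Analysis" "HOL-Computational_Algebra.Polynomial"
begin

definition int_vec :: "int^'d \<Rightarrow> real^'d" where
  "int_vec a = (\<chi> j. of_int (a $ j))"

definition lattice_pts :: "(real^'d) set" where
  "lattice_pts = {x. \<forall>j. x $ j \<in> \<int>}"

definition ineq_set :: "nat \<Rightarrow> (nat \<Rightarrow> int^'d) \<Rightarrow> (nat \<Rightarrow> int) \<Rightarrow> (real^'d) set" where
  "ineq_set m a b = {x. \<forall>i<m. int_vec (a i) \<bullet> x \<ge> of_int (b i)}"

definition primitive_pair :: "int^'d \<Rightarrow> int \<Rightarrow> bool" where
  "primitive_pair a b \<longleftrightarrow> (\<forall>c::int. (\<forall>j. c dvd a $ j) \<and> c dvd b \<longrightarrow> is_unit c)"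

definition irredundant :: "nat \<Rightarrow> (nat \<Rightarrow> int^'d) \<Rightarrow> (nat \<Rightarrow> int) \<Rightarrow> bool" where
  "irredundant m a b \<longleftrightarrow>
     (\<forall>j<m. {x. \<forall>i<m. i \<noteq> j \<longrightarrow> int_vec (a i) \<bullet> x \<ge> of_int (b i)} \<noteq> ineq_set m a b)"

definition polytope_rep :: "(real^'d) set \<Rightarrow> nat \<Rightarrow> (nat \<Rightarrow> int^'d) \<Rightarrow> (nat \<Rightarrow> int) \<Rightarrow> bool" where
  "polytope_rep P m a b \<longleftrightarrow>
     P = ineq_set m a b \<and> bounded P \<and> interior P \<noteq> {} \<and>
     (\<forall>i<m. primitive_pair (a i) (b i)) \<and> irredundant m a b"

text \<open>The open cell of \<open>\<Delta>_P\<close> (arrangement of all hyperplanes \<open>(a_i,x) = k\<close>, \<open>k \<in> \<int>\<close>)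
  containing \<open>x\<close>: the points lying on the same side of / on every such hyperplane as \<open>x\<close>.\<close>
definition Delta_cell :: "nat \<Rightarrow> (nat \<Rightarrow> int^'d) \<Rightarrow> real^'d \<Rightarrow> (real^'d) set" where
  "Delta_cell m a x = {y. \<forall>i<m.
      \<lfloor>int_vec (a i) \<bullet> y\<rfloor> = \<lfloor>int_vec (a i) \<bullet> x\<rfloor> \<and>
      \<lceil>int_vec (a i) \<bullet> y\<rceil> = \<lceil>int_vec (a i) \<bullet> x\<rceil>}"

definition Delta_cells :: "nat \<Rightarrow> (nat \<Rightarrow> int^'d) \<Rightarrow> (real^'d) set set" where
  "Delta_cells m a = range (Delta_cell m a)"

definition TL :: "(real^'d) set \<Rightarrow> real^'d \<Rightarrow> real \<Rightarrow> nat" where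
  "TL P v t = card ((\<lambda>p. t *\<^sub>R p + v) ` P \<inter> lattice_pts)"

definition is_constituent :: "(int \<Rightarrow> real) \<Rightarrow> int \<Rightarrow> real poly \<Rightarrow> bool" where
  "is_constituent F k f \<longleftrightarrow>
     (\<exists>q::int. q > 0 \<and> (\<forall>t::int. t \<ge> 1 \<and> t mod q = k mod q \<longrightarrow> F t = poly f (of_int t)))"

end

(*
  Let L_v(t) = #((tP + v) Int Z^d). Moving v inside an open cell does not change L_v, so v may be
  taken generic over the rationals. The cone over P x {1} is cut out of a simplicial cone by the
  half-spaces a_i x >= b_i t, and each cut is resolved by Elliott's reduction, which splits a
  simplicial cone along the hyperplane; a generic translate has no lattice points on the new walls,
  so the counts add up exactly. For a simplicial cone with generators of equal height D, tiling by
  the fundamental parallelepiped gives a sum of terms B((t - h)/D) with B(s) = (s+n-1 choose n-1),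
  and the reflection of the parallelepiped gives the irrational Ehrhart reciprocity
  L_v(-t) = (-1)^d L_{-v}(t) (after Beck and Sottile). Finally -P = P + u yields L_{-v}(t) = L_v(t).
*)

theory Submission
  imports Defs
begin

text \<open>Reciprocity normally exchanges closed and open cones, and cutting a cone normally calls
  for corrections along the common faces. Both effects vanish when no lattice point lies on any
  wall, which is the purpose of genericity: all counts can then be made with strict inequalities,
  for \<open>v\<close> and for \<open>- v\<close> alike. Full dimension of the cell alone does not
  give this. It keeps \<open>v\<close> off the hyperplanes of \<Delta>_P, but the walls created by
  cutting are further rational hyperplanes.

  The sign has exponent \<open>d\<close> because the cone lives in dimension d + 1 and the binomial
  polynomial has degree one less than the number of generators. The constituents of \<open>k\<close>
  and \<open>- k\<close> are paired because the integers congruent to \<open>- k\<close> are the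
  negatives of those congruent to \<open>k\<close>: a single polynomial piece of a quasi-polynomial
  on all of the integers carries both.\<close>

subsection \<open>Lattice points and quasi-polynomials\<close>

text \<open>The last coordinate carries the dilation factor \<open>t\<close>: lattice points of \<open>tP + v\<close> are those
  points of \<open>lat\<close> at height \<open>t\<close> that lie in the cone over \<open>P \<times> {1}\<close> translated by \<open>(v, 0)\<close>.\<close>

definition lat :: "((real^'d) \<times> real) set" where
  "lat = lattice_pts \<times> \<int>"

lemma lat_add: "x \<in> lat \<Longrightarrow> y \<in> lat \<Longrightarrow> x + y \<in> lat"
  by (auto simp: lat_def lattice_pts_def)

lemma lat_diff: "x \<in> lat \<Longrightarrow> y \<in> lat \<Longrightarrow> x - y \<in> lat"
  by (auto simp: lat_def lattice_pts_def)

lemma lat_uminus: "x \<in> lat \<Longrightarrow> - x \<in> lat"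
  by (auto simp: lat_def lattice_pts_def)

lemma lat_scaleR: "r \<in> \<int> \<Longrightarrow> x \<in> lat \<Longrightarrow> r *\<^sub>R x \<in> lat"
  by (auto simp: lat_def lattice_pts_def)

lemma lat_sum: "(\<And>i. i \<in> I \<Longrightarrow> f i \<in> lat) \<Longrightarrow> sum f I \<in> lat"
proof (induction I rule: infinite_finite_induct)
  case (insert x F)
  then show ?case by (auto intro: lat_add)
qed (auto simp: lat_def lattice_pts_def zero_prod_def)

lemma finite_lattice_pts_bounded:
  fixes S :: "(real^'d) set"
  assumes "bounded S"
  shows "finite (S \<inter> lattice_pts)"
proof -
  obtain B where B: "\<And>x. x \<in> S \<Longrightarrow> norm x \<le> B"
    using assms by (auto simp: bounded_iff)
  let ?I = "{r::real. r \<in> \<int> \<and> \<bar>r\<bar> \<le> B}"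
  have fin: "finite ?I"
    by (rule finite_abs_int_segment)
  have "S \<inter> lattice_pts \<subseteq> (\<lambda>f. \<chi> j. f j) ` (UNIV \<rightarrow>\<^sub>E ?I)"
  proof
    fix x assume x: "x \<in> S \<inter> lattice_pts"
    have "\<bar>x $ j\<bar> \<le> B" for j
      using component_le_norm_cart[of x j] B[of x] x by auto
    then have "(\<lambda>j. x $ j) \<in> UNIV \<rightarrow>\<^sub>E ?I"
      using x by (auto simp: lattice_pts_def)
    moreover have "x = (\<chi> j. x $ j)" by simp
    ultimately show "x \<in> (\<lambda>f. \<chi> j. f j) ` (UNIV \<rightarrow>\<^sub>E ?I)"
      by (metis image_eqI)
  qed
  moreover have "finite ((\<lambda>f. (\<chi> j. f j) :: real^'d) ` (UNIV \<rightarrow>\<^sub>E ?I))"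
    by (intro finite_imageI finite_PiE) (auto simp: fin)
  ultimately show ?thesis by (rule finite_subset)
qed

lemma finite_lat_bounded:
  fixes S :: "((real^'d) \<times> real) set"
  assumes "bounded S"
  shows "finite (S \<inter> lat)"
proof -
  obtain B where B: "\<And>t. t \<in> snd ` S \<Longrightarrow> \<bar>t\<bar> \<le> B"
    using bounded_snd[OF assms] by (auto simp: bounded_iff)
  have "S \<inter> lat \<subseteq> (fst ` S \<inter> lattice_pts) \<times> {r. r \<in> \<int> \<and> \<bar>r\<bar> \<le> B}"
    using B by (force simp: lat_def)
  moreover have "finite ((fst ` S \<inter> lattice_pts) \<times> {r::real. r \<in> \<int> \<and> \<bar>r\<bar> \<le> B})"
    by (intro finite_cartesian_product finite_lattice_pts_bounded bounded_fst assms
        finite_abs_int_segment)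
  ultimately show ?thesis by (rule finite_subset)
qed

section \<open>Counting compositions\<close>

text \<open>Stars and bars: enumerating the index type without repetition turns compositions into
  lists of fixed length and sum.\<close>

lemma card_compositions:
  "card {\<nu>::'n::finite \<Rightarrow> nat. sum \<nu> UNIV = s} = (s + CARD('n) - 1) choose (CARD('n) - 1)"
proof -
  obtain xs :: "'n list" where xs: "set xs = UNIV" "distinct xs"
    using finite_distinct_list[of "UNIV :: 'n set"] by auto
  have len: "length xs = CARD('n)"
    using xs distinct_card by fastforce
  have sums: "sum_list (map \<nu> xs) = sum \<nu> UNIV" for \<nu> :: "'n \<Rightarrow> nat"
    using xs sum_list_distinct_conv_sum_set by metis
  have "bij_betw (\<lambda>\<nu>. map \<nu> xs) {\<nu>. sum \<nu> UNIV = s}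
      {l. length l = length xs \<and> sum_list l = s}"
  proof (rule bij_betwI')
    fix \<nu> \<mu> :: "'n \<Rightarrow> nat"
    show "(map \<nu> xs = map \<mu> xs) = (\<nu> = \<mu>)"
      using xs by (auto simp: fun_eq_iff)
  next
    fix \<nu> :: "'n \<Rightarrow> nat" assume "\<nu> \<in> {\<nu>. sum \<nu> UNIV = s}"
    then show "map \<nu> xs \<in> {l. length l = length xs \<and> sum_list l = s}"
      by (simp add: sums)
  next
    fix l assume l: "l \<in> {l. length l = length xs \<and> sum_list l = s}"
    define \<nu> where "\<nu> x = the (map_of (zip xs l) x)" for x
    have "map \<nu> xs = l"
      using l xs by (intro nth_equalityI) (auto simp: \<nu>_def map_of_zip_nth)
    then show "\<exists>\<nu>\<in>{\<nu>. sum \<nu> UNIV = s}. l = map \<nu> xs"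
      using l sums by (intro bexI[of _ \<nu>]) auto
  qed
  then have "card {\<nu>::'n \<Rightarrow> nat. sum \<nu> UNIV = s} = (s + length xs - 1) choose s"
    by (simp add: bij_betw_same_card card_length_sum_list)
  also have "\<dots> = (s + CARD('n) - 1) choose (CARD('n) - 1)"
    using binomial_symmetric[of s "s + CARD('n) - 1"] zero_less_card_finite[where 'a = 'n]
    by (simp add: len Suc_leI del: zero_less_card_finite)
  finally show ?thesis .
qed

text \<open>The closed form also covers the negative \<open>s\<close> for which the binomial polynomial vanishes.\<close>

lemma card_compositions_int:
  assumes "s > - int CARD('n)"
  shows "real (card {\<nu>::'n::finite \<Rightarrow> nat. int (sum \<nu> UNIV) = s}) =
    (of_int s + real CARD('n) - 1) gchoose (CARD('n) - 1)"
proof (cases "s \<ge> 0")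
  case True
  have "{\<nu>::'n \<Rightarrow> nat. int (sum \<nu> UNIV) = s} = {\<nu>. sum \<nu> UNIV = nat s}"
    using True by (auto simp del: of_nat_sum)
  then have "real (card {\<nu>::'n \<Rightarrow> nat. int (sum \<nu> UNIV) = s}) =
      real ((nat s + CARD('n) - 1) choose (CARD('n) - 1))"
    by (simp add: card_compositions del: of_nat_sum)
  also have "\<dots> = (real (nat s + CARD('n) - 1) gchoose (CARD('n) - 1))"
    by (rule binomial_gbinomial)
  also have "real (nat s + CARD('n) - 1) = of_int s + real CARD('n) - 1"
    using True by (simp add: of_nat_diff Suc_leI)
  finally show ?thesis .
next
  case False
  have "{\<nu>::'n \<Rightarrow> nat. int (sum \<nu> UNIV) = s} = {}"
    using False by (auto simp del: of_nat_sum)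
  moreover have "(of_int s + real CARD('n) - 1) = real (nat (s + int CARD('n) - 1))"
    using assms by simp
  moreover have "nat (s + int CARD('n) - 1) choose (CARD('n) - 1) = 0"
    using False assms by (intro binomial_eq_0) linarith
  ultimately show ?thesis
    by (metis binomial_gbinomial card.empty of_nat_0)
qed

lemma gbinomial_poly:
  fixes p :: "real poly"
  shows "\<exists>q. \<forall>x. poly q x = poly p x gchoose k"
proof (intro exI allI)
  show "poly (smult (1 / fact k) (\<Prod>i\<in>{0..<k}. p - [:of_nat i:])) x = poly p x gchoose k" for x
    by (simp add: gbinomial_prod_rev poly_prod)
qed

section \<open>Quasi-polynomials and reciprocal pairs of counting functions\<close>

text \<open>Negative \<open>t\<close> are included, unlike in \<open>is_constituent\<close>, because
  reciprocity evaluates the same polynomial pieces at \<open>- t\<close>.\<close>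

definition quasi_poly :: "(int \<Rightarrow> real) \<Rightarrow> bool" where
  "quasi_poly F \<longleftrightarrow>
    (\<exists>D::int. D > 0 \<and> (\<forall>r. \<exists>p. \<forall>t. t mod D = r mod D \<longrightarrow> F t = poly p (of_int t)))"

lemma quasi_poly_add:
  assumes "quasi_poly F" "quasi_poly G"
  shows "quasi_poly (\<lambda>t. F t + G t)"
proof -
  obtain D where D: "D > 0" "\<And>r. \<exists>p. \<forall>t. t mod D = r mod D \<longrightarrow> F t = poly p (of_int t)"
    using assms(1) unfolding quasi_poly_def by blast
  obtain E where E: "E > 0" "\<And>r. \<exists>p. \<forall>t. t mod E = r mod E \<longrightarrow> G t = poly p (of_int t)"
    using assms(2) unfolding quasi_poly_def by blast
  have "\<exists>p. \<forall>t. t mod (D * E) = r mod (D * E) \<longrightarrow> F t + G t = poly p (of_int t)" for r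
  proof -
    obtain p q where p: "\<And>t. t mod D = r mod D \<Longrightarrow> F t = poly p (of_int t)"
      and q: "\<And>t. t mod E = r mod E \<Longrightarrow> G t = poly q (of_int t)"
      using D(2)[of r] E(2)[of r] by blast
    have *: "t mod D = r mod D \<and> t mod E = r mod E" if "t mod (D * E) = r mod (D * E)" for t
      using that by (metis dvd_triv_left dvd_triv_right mod_mod_cancel)
    show ?thesis
    proof (intro exI allI impI)
      fix t assume "t mod (D * E) = r mod (D * E)"
      then show "F t + G t = poly (p + q) (of_int t)"
        using p[of t] q[of t] *[of t] by simp
    qed
  qed
  moreover have "D * E > 0"
    using D(1) E(1) by simp
  ultimately show ?thesis
    unfolding quasi_poly_def by blast
qed

lemma quasi_poly_0: "quasi_poly (\<lambda>t. 0)"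
  unfolding quasi_poly_def by (intro exI[of _ 1]) (auto intro!: exI[of _ 0])

lemma quasi_poly_sum: "(\<And>i. i \<in> I \<Longrightarrow> quasi_poly (F i)) \<Longrightarrow> quasi_poly (\<lambda>t. \<Sum>i\<in>I. F i t)"
  by (induction I rule: infinite_finite_induct) (auto intro: quasi_poly_0 quasi_poly_add)

text \<open>This is the shape of the contribution of one point of height \<tau> in the fundamental
  parallelepiped: generators of height \<open>D\<close> raise it in steps of \<open>D\<close>, so it
  matters for one residue class of \<open>t\<close> only, and there the division by \<open>D\<close>
  is exact.\<close>

lemma quasi_poly_gbinomial_residue:
  fixes D \<tau> :: int
  assumes "D > 0"
  shows "quasi_poly (\<lambda>t. if D dvd t - \<tau> then (of_int ((t - \<tau>) div D) + e) gchoose k else 0)"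
proof -
  obtain q where q: "\<And>x. poly q x = poly [:e - of_int \<tau> / of_int D, 1 / of_int D:] x gchoose k"
    using gbinomial_poly by blast
  have "(if D dvd t - \<tau> then (of_int ((t - \<tau>) div D) + e) gchoose k else 0) =
      poly (if D dvd r - \<tau> then q else 0) (of_int t)" if "t mod D = r mod D" for r t
  proof -
    have "D dvd t - \<tau> \<longleftrightarrow> D dvd r - \<tau>"
      using that by (metis mod_diff_left_eq dvd_eq_mod_eq_0)
    moreover have "of_int ((t - \<tau>) div D) + e = poly [:e - of_int \<tau> / of_int D, 1 / of_int D:] (of_int t)"
      if "D dvd t - \<tau>"
      using that by (simp add: real_of_int_div diff_divide_distrib)
    ultimately show ?thesis
      by (simp add: q del: poly_pCons)
  qed
  then have "\<exists>p. \<forall>t. t mod D = r mod D \<longrightarrow>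
      (if D dvd t - \<tau> then (of_int ((t - \<tau>) div D) + e) gchoose k else 0) = poly p (of_int t)" for r
    by blast
  then show ?thesis
    unfolding quasi_poly_def using assms by (intro exI[of _ D]) simp
qed

text \<open>One quasi-polynomial interpolates \<open>N\<close> at positive and, up to sign,
  \<open>N'\<close> at negative arguments, with no condition at 0. As a relation between counting
  functions it is additive, so it survives the cutting of cones.\<close>

definition reciprocal :: "nat \<Rightarrow> (int \<Rightarrow> nat) \<Rightarrow> (int \<Rightarrow> nat) \<Rightarrow> bool" where
  "reciprocal n N N' \<longleftrightarrow> (\<exists>F. quasi_poly F \<and>
    (\<forall>t\<ge>1. F t = real (N t) \<and> F (- t) = (-1) ^ n * real (N' t)))"

lemma reciprocal_0: "reciprocal n (\<lambda>t. 0) (\<lambda>t. 0)"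
  unfolding reciprocal_def by (intro exI[of _ "\<lambda>t. 0"]) (auto simp: quasi_poly_0)

lemma reciprocal_add:
  assumes "reciprocal n N N'" "reciprocal n M M'"
  shows "reciprocal n (\<lambda>t. N t + M t) (\<lambda>t. N' t + M' t)"
proof -
  obtain F G where "quasi_poly F" "\<forall>t\<ge>1. F t = real (N t) \<and> F (- t) = (-1) ^ n * real (N' t)"
    "quasi_poly G" "\<forall>t\<ge>1. G t = real (M t) \<and> G (- t) = (-1) ^ n * real (M' t)"
    using assms unfolding reciprocal_def by blast
  then show ?thesis
    unfolding reciprocal_def
    by (intro exI[of _ "\<lambda>t. F t + G t"]) (auto simp: quasi_poly_add algebra_simps)
qed

lemma reciprocal_cong:
  assumes "reciprocal n M M'" "\<And>t. t \<ge> 1 \<Longrightarrow> N t = M t" "\<And>t. t \<ge> 1 \<Longrightarrow> N' t = M' t"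
  shows "reciprocal n N N'"
proof -
  obtain F where "quasi_poly F" "\<forall>t\<ge>1. F t = real (M t) \<and> F (- t) = (-1) ^ n * real (M' t)"
    using assms(1) unfolding reciprocal_def by blast
  then show ?thesis
    unfolding reciprocal_def using assms(2,3) by (intro exI[of _ F]) simp
qed

subsection \<open>Simplicial cones\<close>

text \<open>The \<open>c i\<close> are the coordinates with respect to the generators of a
  simplicial cone, and \<open>hs\<close> holds the half-spaces by which it still has to be
  cut.\<close>

definition cone_pts ::
    "('n \<Rightarrow> (real^'d) \<times> real \<Rightarrow> real) \<Rightarrow> ((real^'d) \<times> real \<Rightarrow> real) list \<Rightarrow> (real^'d) \<times> real \<Rightarrow>
      int \<Rightarrow> ((real^'d) \<times> real) set" where
  "cone_pts c hs V t = {y \<in> lat. snd y = of_int t \<and> (\<forall>i. 0 < c i (y - V)) \<and>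
    (\<forall>h\<in>set hs. 0 < h (y - V))}"

definition off_walls :: "('n \<Rightarrow> (real^'d) \<times> real \<Rightarrow> real) \<Rightarrow> (real^'d) \<times> real \<Rightarrow> bool" where
  "off_walls c V \<longleftrightarrow> (\<forall>y\<in>lat. \<forall>i. c i (y - V) \<noteq> 0)"

text \<open>Generators and dual basis are carried together, so that a cut is a substitution in both
  and no matrix has to be inverted. Rationality of the coordinates on \<open>lat\<close> is what
  lets generic translates avoid the walls; positive heights make each slice of the cone
  bounded.\<close>

locale simplicial_cone =
  fixes w :: "'n::finite \<Rightarrow> (real^'d) \<times> real" and c :: "'n \<Rightarrow> (real^'d) \<times> real \<Rightarrow> real"
  assumes w_lat: "w i \<in> lat" and height_pos: "0 < snd (w i)"
    and lin: "linear (c i)" and rat: "y \<in> lat \<Longrightarrow> c i y \<in> \<rat>"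
    and dual: "c i (w j) = (if i = j then 1 else 0)"
    and expand: "(\<Sum>i\<in>UNIV. c i y *\<^sub>R w i) = y"
begin

lemma snd_expand: "snd y = (\<Sum>i\<in>UNIV. c i y * snd (w i))"
  by (subst (1) expand[of y, symmetric]) (simp add: snd_sum)

lemma coord_shift: "c i (p + (\<Sum>j\<in>UNIV. r j *\<^sub>R w j)) = c i p + r i"
proof -
  interpret linear "c i" by (rule lin)
  have "c i (p + (\<Sum>j\<in>UNIV. r j *\<^sub>R w j)) = c i p + (\<Sum>j\<in>UNIV. r j * c i (w j))"
    by (simp add: add sum scaleR)
  also have "(\<Sum>j\<in>UNIV. r j * c i (w j)) = r i"
    by (simp add: dual if_distrib cong: if_cong)
  finally show ?thesis .
qed

lemma off_walls_uminus:
  assumes "off_walls c V"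
  shows "off_walls c (- V)"
  unfolding off_walls_def
proof (intro ballI allI)
  fix y :: "(real^'d) \<times> real" and i assume "y \<in> lat"
  then have "c i (- y - V) \<noteq> 0"
    using assms lat_uminus unfolding off_walls_def by blast
  moreover have "c i (- y - V) = - c i (y - (- V))"
    using linear_neg[OF lin, of i "y - (- V)"] by simp
  ultimately show "c i (y - (- V)) \<noteq> 0" by simp
qed

lemma finite_bounded_coords:
  assumes "\<And>y i. y \<in> S \<Longrightarrow> 0 \<le> c i (y - V) \<and> c i (y - V) \<le> B"
  shows "finite (S \<inter> lat)"
proof (rule finite_lat_bounded)
  have "norm y \<le> norm V + (\<Sum>i\<in>UNIV. B * norm (w i))" if "y \<in> S" for y
  proof -
    have "norm (y - V) = norm (\<Sum>i\<in>UNIV. c i (y - V) *\<^sub>R w i)"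
      by (simp only: expand)
    also have "\<dots> \<le> (\<Sum>i\<in>UNIV. B * norm (w i))"
      using assms[OF that] by (intro sum_norm_le) (auto intro: mult_right_mono)
    finally show ?thesis
      using norm_triangle_sub[of y V] by linarith
  qed
  then show "bounded S"
    by (rule boundedI)
qed

text \<open>Since all generators have positive height, the height \<open>t\<close> bounds every
  single coordinate.\<close>

lemma finite_cone_pts:
  assumes "snd V = 0"
  shows "finite (cone_pts c hs V t)"
proof -
  define B where "B = (\<Sum>i\<in>UNIV. \<bar>of_int t\<bar> / snd (w i))"
  have "0 \<le> c i (y - V) \<and> c i (y - V) \<le> B" if y: "y \<in> cone_pts c hs V t" for y i
  proof
    have pos: "0 < c j (y - V)" for j
      using y by (auto simp: cone_pts_def)
    then show "0 \<le> c i (y - V)" by (simp add: less_imp_le)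
    have "c i (y - V) * snd (w i) \<le> (\<Sum>j\<in>UNIV. c j (y - V) * snd (w j))"
      using pos height_pos by (intro member_le_sum) (auto intro: less_imp_le)
    also have "\<dots> = of_int t"
      using y snd_expand[of "y - V"] assms by (simp add: cone_pts_def)
    also have "\<dots> \<le> \<bar>of_int t\<bar>" by simp
    finally have "c i (y - V) \<le> \<bar>of_int t\<bar> / snd (w i)"
      using height_pos[of i] by (simp add: field_simps)
    also have "\<dots> \<le> B"
      unfolding B_def using height_pos
      by (intro member_le_sum[where f = "\<lambda>i. \<bar>of_int t\<bar> / snd (w i)"])
        (auto intro!: divide_nonneg_pos)
    finally show "c i (y - V) \<le> B" .
  qed
  then have "finite (cone_pts c hs V t \<inter> lat)"
    by (rule finite_bounded_coords)
  moreover have "cone_pts c hs V t \<inter> lat = cone_pts c hs V t"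
    by (auto simp: cone_pts_def)
  ultimately show ?thesis by simp
qed

section \<open>Tiling by the fundamental parallelepiped\<close>

text \<open>Off the walls, the open parallelepiped has the same lattice points as the half-open one,
  because a coordinate 1 would become 0 after subtracting a generator. So the same set both tiles
  the cone and is centrally symmetric.\<close>

definition box_pts :: "(real^'d) \<times> real \<Rightarrow> ((real^'d) \<times> real) set" where
  "box_pts V = {p \<in> lat. \<forall>i. 0 < c i (p - V) \<and> c i (p - V) < 1}"

lemma finite_box_pts: "finite (box_pts V)"
proof -
  have "finite (box_pts V \<inter> lat)"
    by (rule finite_bounded_coords[of _ V 1]) (auto simp: box_pts_def less_imp_le)
  moreover have "box_pts V \<inter> lat = box_pts V"
    by (auto simp: box_pts_def)
  ultimately show ?thesis by simp
qed

text \<open>The reflection sends each coordinate \<open>s\<close> to \<open>1 - s\<close>, which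
  preserves the open interval from 0 to 1.\<close>

lemma box_pts_reflect:
  assumes "p \<in> box_pts V"
  shows "(\<Sum>i\<in>UNIV. w i) - p \<in> box_pts (- V)"
proof -
  have "c i ((\<Sum>i\<in>UNIV. w i) - p - (- V)) = 1 - c i (p - V)" for i
    using coord_shift[of i "- (p - V)" "\<lambda>_. 1"] linear_neg[OF lin, of i "p - V"]
    by (simp add: algebra_simps)
  then show ?thesis
    using assms by (auto simp: box_pts_def intro!: lat_diff lat_sum w_lat)
qed

text \<open>Integer and fractional parts of the coordinates separate a cone point into \<nu> and a
  box point; off the walls no fractional part is 0. With equal heights, the height of the point
  depends on \<nu> through its sum only, which leads to compositions.\<close>

lemma bij_betw_cone_pts:
  assumes off: "off_walls c V"
    and height: "\<And>i. snd (w i) = of_int D"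
  shows "bij_betw (\<lambda>(p, \<nu>). p + (\<Sum>i\<in>UNIV. real (\<nu> i) *\<^sub>R w i))
    (SIGMA p:box_pts V. {\<nu>. int (sum \<nu> UNIV) * D = t - \<lfloor>snd p\<rfloor>}) (cone_pts c [] V t)"
proof (rule bij_betw_byWitness[where f' = "\<lambda>y. (y - (\<Sum>i\<in>UNIV. real (nat \<lfloor>c i (y - V)\<rfloor>) *\<^sub>R w i),
      \<lambda>i. nat \<lfloor>c i (y - V)\<rfloor>)"], goal_cases)
  case 1
  have "nat \<lfloor>c j (p + (\<Sum>i\<in>UNIV. real (\<nu> i) *\<^sub>R w i) - V)\<rfloor> = \<nu> j" if "p \<in> box_pts V" for p \<nu> j
  proof -
    have "c j (p + (\<Sum>i\<in>UNIV. real (\<nu> i) *\<^sub>R w i) - V) = c j (p - V) + real (\<nu> j)"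
      using coord_shift[of j "p - V" "\<lambda>i. real (\<nu> i)"] by (simp add: algebra_simps)
    moreover have "\<lfloor>c j (p - V)\<rfloor> = 0"
      using that by (auto simp: box_pts_def floor_eq_iff less_imp_le)
    ultimately show ?thesis by simp
  qed
  then show ?case by auto
next
  case 2
  show ?case by simp
next
  case 3
  show ?case
  proof (rule image_subsetI)
    fix x :: "((real^'d) \<times> real) \<times> ('n \<Rightarrow> nat)"
    assume "x \<in> (SIGMA p:box_pts V. {\<nu>. int (sum \<nu> UNIV) * D = t - \<lfloor>snd p\<rfloor>})"
    then obtain p \<nu> where x: "x = (p, \<nu>)" and p: "p \<in> box_pts V"
      and \<nu>: "int (sum \<nu> UNIV) * D = t - \<lfloor>snd p\<rfloor>"
      by auto
    let ?y = "p + (\<Sum>i\<in>UNIV. real (\<nu> i) *\<^sub>R w i)"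
    have p_lat: "p \<in> lat" using p by (simp add: box_pts_def)
    then have "snd p = of_int \<lfloor>snd p\<rfloor>"
      by (auto simp: lat_def elim: Ints_cases)
    then have "snd ?y = of_int (\<lfloor>snd p\<rfloor> + int (sum \<nu> UNIV) * D)"
      by (simp add: snd_sum height sum_distrib_right)
    also have "\<dots> = of_int t" by (simp only: \<nu>)
    finally have "snd ?y = of_int t" .
    moreover have "0 < c i (?y - V)" for i
    proof -
      have "c i (?y - V) = c i (p - V) + real (\<nu> i)"
        using coord_shift[of i "p - V" "\<lambda>i. real (\<nu> i)"] by (simp add: algebra_simps)
      then show ?thesis using p by (simp add: box_pts_def add_pos_nonneg)
    qed
    moreover have "?y \<in> lat"
      using p_lat by (intro lat_add lat_sum lat_scaleR w_lat) auto
    ultimately show "(case x of (p, \<nu>) \<Rightarrow> p + (\<Sum>i\<in>UNIV. real (\<nu> i) *\<^sub>R w i)) \<in> cone_pts c [] V t"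
      by (auto simp: cone_pts_def x)
  qed
next
  case 4
  show ?case
  proof (rule image_subsetI)
    fix y assume y: "y \<in> cone_pts c [] V t"
    define \<nu> where "\<nu> i = nat \<lfloor>c i (y - V)\<rfloor>" for i
    let ?p = "y - (\<Sum>i\<in>UNIV. real (\<nu> i) *\<^sub>R w i)"
    have y_lat: "y \<in> lat" using y by (simp add: cone_pts_def)
    have p_lat: "?p \<in> lat"
      using y_lat by (intro lat_diff lat_sum lat_scaleR w_lat) auto
    have coord: "c i (?p - V) = frac (c i (y - V))" for i
    proof -
      have "0 < c i (y - V)" using y by (simp add: cone_pts_def)
      moreover have "c i (?p - V) = c i (y - V) - real (\<nu> i)"
        using coord_shift[of i "y - V" "\<lambda>i. - real (\<nu> i)"] by (simp add: algebra_simps sum_negf)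
      ultimately show ?thesis by (simp add: \<nu>_def frac_def)
    qed
    have "?p \<in> box_pts V"
    proof -
      have "c i (?p - V) \<noteq> 0" for i
        using off p_lat by (auto simp: off_walls_def)
      then show ?thesis
        using p_lat by (auto simp: box_pts_def coord frac_lt_1 frac_gt_0_iff)
    qed
    moreover have "int (sum \<nu> UNIV) * D = t - \<lfloor>snd ?p\<rfloor>"
    proof -
      have "snd ?p = of_int (t - int (sum \<nu> UNIV) * D)"
        using y by (simp add: cone_pts_def snd_sum height sum_distrib_right)
      then show ?thesis by (simp only: floor_of_int)
    qed
    ultimately show "(y - (\<Sum>i\<in>UNIV. real (nat \<lfloor>c i (y - V)\<rfloor>) *\<^sub>R w i), \<lambda>i. nat \<lfloor>c i (y - V)\<rfloor>)
        \<in> (SIGMA p:box_pts V. {\<nu>. int (sum \<nu> UNIV) * D = t - \<lfloor>snd p\<rfloor>})"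
      unfolding \<nu>_def by blast
  qed
qed

text \<open>A box point higher than \<open>t\<close> admits no composition, and the binomial
  polynomial agrees: its zeros -(n-1), ..., -1 cover all negative values of (t - height)/D that can
  occur. Hence one formula serves every box point.\<close>

lemma card_cone_pts_equal_heights:
  assumes off: "off_walls c V" and V: "snd V = 0" and t: "t \<ge> 1"
    and height: "\<And>i. snd (w i) = of_int D"
  shows "real (card (cone_pts c [] V t)) =
    (\<Sum>p\<in>box_pts V. if D dvd t - \<lfloor>snd p\<rfloor>
      then (of_int ((t - \<lfloor>snd p\<rfloor>) div D) + (real CARD('n) - 1)) gchoose (CARD('n) - 1) else 0)"
proof -
  have D: "D > 0"
    using height_pos[of undefined] by (simp add: height)
  have fin: "finite {\<nu>::'n \<Rightarrow> nat. int (sum \<nu> UNIV) * D = s}" for s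
  proof (rule finite_subset)
    show "{\<nu>::'n \<Rightarrow> nat. int (sum \<nu> UNIV) * D = s} \<subseteq> UNIV \<rightarrow>\<^sub>E {..nat s}"
    proof
      fix \<nu> :: "'n \<Rightarrow> nat" assume "\<nu> \<in> {\<nu>. int (sum \<nu> UNIV) * D = s}"
      then have "s = int (sum \<nu> UNIV) * D" by simp
      then have "int (sum \<nu> UNIV) \<le> s"
        using D by (simp add: mult_le_cancel_left1 del: of_nat_sum)
      moreover have "\<nu> i \<le> sum \<nu> UNIV" for i
        by (intro member_le_sum) auto
      ultimately have "\<nu> i \<le> nat s" for i
        by (metis le_nat_iff of_nat_0_le_iff order_trans of_nat_le_iff)
      then show "\<nu> \<in> UNIV \<rightarrow>\<^sub>E {..nat s}" by auto
    qed
  qed (auto intro: finite_PiE)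
  have "card (cone_pts c [] V t) =
      card (SIGMA p:box_pts V. {\<nu>::'n \<Rightarrow> nat. int (sum \<nu> UNIV) * D = t - \<lfloor>snd p\<rfloor>})"
    using bij_betw_same_card[OF bij_betw_cone_pts[OF off height, of t]] by simp
  also have "\<dots> = (\<Sum>p\<in>box_pts V. card {\<nu>::'n \<Rightarrow> nat. int (sum \<nu> UNIV) * D = t - \<lfloor>snd p\<rfloor>})"
    using fin by (intro card_SigmaI finite_box_pts) blast
  finally have "real (card (cone_pts c [] V t)) =
      (\<Sum>p\<in>box_pts V. real (card {\<nu>::'n \<Rightarrow> nat. int (sum \<nu> UNIV) * D = t - \<lfloor>snd p\<rfloor>}))"
    by simp
  also have "\<dots> = (\<Sum>p\<in>box_pts V. if D dvd t - \<lfloor>snd p\<rfloor>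
      then (of_int ((t - \<lfloor>snd p\<rfloor>) div D) + (real CARD('n) - 1)) gchoose (CARD('n) - 1) else 0)"
  proof (intro sum.cong refl)
    fix p assume p: "p \<in> box_pts V"
    define s where "s = t - \<lfloor>snd p\<rfloor>"
    \<comment> \<open>Coordinates below 1 on \<open>CARD('n)\<close> generators of height
      \<open>D\<close> keep a box point below height \<open>CARD('n) * D\<close>; with positive
      \<open>t\<close> this confines \<open>s\<close> to the range of
      \<open>card_compositions_int\<close>.\<close>
    have "snd p = (\<Sum>i\<in>UNIV. c i (p - V) * of_int D)"
      using snd_expand[of "p - V"] V by (simp add: height)
    also have "\<dots> < (\<Sum>i\<in>(UNIV :: 'n set). of_int D)"
      using p D by (intro sum_strict_mono) (auto simp: box_pts_def)
    also have "\<dots> = of_int (int CARD('n) * D)" by simp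
    finally have "\<lfloor>snd p\<rfloor> < int CARD('n) * D"
      by (simp only: floor_less_iff)
    then have s: "s > - int CARD('n) * D"
      using t by (simp add: s_def)
    show "real (card {\<nu>::'n \<Rightarrow> nat. int (sum \<nu> UNIV) * D = t - \<lfloor>snd p\<rfloor>}) =
      (if D dvd t - \<lfloor>snd p\<rfloor>
       then (of_int ((t - \<lfloor>snd p\<rfloor>) div D) + (real CARD('n) - 1)) gchoose (CARD('n) - 1) else 0)"
      unfolding s_def[symmetric]
    proof (cases "D dvd s")
      case True
      then obtain e where e: "s = e * D" by (metis dvdE mult.commute)
      have "e > - int CARD('n)"
        using s D unfolding e by (simp only: mult_less_cancel_right_pos)
      then have "real (card {\<nu>::'n \<Rightarrow> nat. int (sum \<nu> UNIV) = e}) =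
          (of_int e + real CARD('n) - 1) gchoose (CARD('n) - 1)"
        by (rule card_compositions_int)
      then show "real (card {\<nu>::'n \<Rightarrow> nat. int (sum \<nu> UNIV) * D = s}) =
        (if D dvd s then (of_int (s div D) + (real CARD('n) - 1)) gchoose (CARD('n) - 1) else 0)"
        using True D by (simp add: e add_diff_eq del: of_nat_sum)
    next
      case False
      then have "{\<nu>::'n \<Rightarrow> nat. int (sum \<nu> UNIV) * D = s} = {}"
        by (auto simp del: of_nat_sum)
      then show "real (card {\<nu>::'n \<Rightarrow> nat. int (sum \<nu> UNIV) * D = s}) =
        (if D dvd s then (of_int (s div D) + (real CARD('n) - 1)) gchoose (CARD('n) - 1) else 0)"
        using False by simp
    qed
  qed
  finally show ?thesis .
qed

text \<open>Under \<open>p \<mapsto> \<Sum>\<^sub>i w\<^sub>i - p\<close> the reciprocity becomes the one of the binomial polynomial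
  \<open>B(s) = (s + n - 1 choose n - 1)\<close>, namely \<open>B(s) = (-1)\<^sup>n\<^sup>-\<^sup>1 B(- s - n)\<close>.\<close>

lemma reciprocal_equal_heights:
  assumes off: "off_walls c V" and V: "snd V = 0"
    and height: "\<And>i. snd (w i) = of_int D"
  shows "reciprocal (CARD('n) - 1) (\<lambda>t. card (cone_pts c [] V t)) (\<lambda>t. card (cone_pts c [] (- V) t))"
proof -
  define n where "n = CARD('n)"
  define F where "F V t = (\<Sum>p\<in>box_pts V. if D dvd t - \<lfloor>snd p\<rfloor>
      then (of_int ((t - \<lfloor>snd p\<rfloor>) div D) + (real n - 1)) gchoose (n - 1) else 0)" for V t
  have D: "D > 0"
    using height_pos[of undefined] by (simp add: height)
  have n: "n \<ge> 1"
    by (simp add: n_def Suc_leI)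
  have "quasi_poly (F V)"
    unfolding F_def by (intro quasi_poly_sum quasi_poly_gbinomial_residue D)
  moreover have "F V t = real (card (cone_pts c [] V t))" if "t \<ge> 1" for t
    unfolding F_def n_def using off V that height by (rule card_cone_pts_equal_heights[symmetric])
  moreover have "F V (- t) = (-1) ^ (n - 1) * real (card (cone_pts c [] (- V) t))" if t: "t \<ge> 1" for t
  proof -
    let ?W = "\<Sum>i\<in>UNIV. w i"
    have "F V (- t) = (\<Sum>p\<in>box_pts (- V). (-1) ^ (n - 1) * (if D dvd t - \<lfloor>snd p\<rfloor>
      then (of_int ((t - \<lfloor>snd p\<rfloor>) div D) + (real n - 1)) gchoose (n - 1) else 0))"
      unfolding F_def
    proof (rule sum.reindex_bij_witness[of _ "\<lambda>p. ?W - p" "\<lambda>p. ?W - p"])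
      fix p assume p: "p \<in> box_pts V"
      then show "?W - p \<in> box_pts (- V)" by (rule box_pts_reflect)
      have "snd p = of_int \<lfloor>snd p\<rfloor>"
        using p by (auto simp: box_pts_def lat_def elim: Ints_cases)
      then have "snd (?W - p) = of_int (int n * D - \<lfloor>snd p\<rfloor>)"
        by (simp add: snd_sum height n_def)
      then have fl: "\<lfloor>snd (?W - p)\<rfloor> = int n * D - \<lfloor>snd p\<rfloor>"
        by (simp only: floor_of_int)
      show "(-1) ^ (n - 1) * (if D dvd t - \<lfloor>snd (?W - p)\<rfloor>
          then (of_int ((t - \<lfloor>snd (?W - p)\<rfloor>) div D) + (real n - 1)) gchoose (n - 1) else 0) =
        (if D dvd - t - \<lfloor>snd p\<rfloor>
          then (of_int ((- t - \<lfloor>snd p\<rfloor>) div D) + (real n - 1)) gchoose (n - 1) else 0)"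
      proof (cases "D dvd - t - \<lfloor>snd p\<rfloor>")
        case True
        then obtain s where s: "- t - \<lfloor>snd p\<rfloor> = D * s" by (rule dvdE)
        then have s': "t - \<lfloor>snd (?W - p)\<rfloor> = D * (- s - int n)"
          unfolding fl by (simp add: algebra_simps)
        have "(of_int s + (real n - 1)) gchoose (n - 1) =
            (-1) ^ (n - 1) * ((of_int (- s - int n) + (real n - 1)) gchoose (n - 1))"
          using n by (subst gbinomial_negated_upper) (simp add: of_nat_diff)
        then show ?thesis
          unfolding s s' using D by simp
      next
        case False
        have "- (t - \<lfloor>snd (?W - p)\<rfloor>) = (- t - \<lfloor>snd p\<rfloor>) + D * int n"
          unfolding fl by (simp add: algebra_simps)
        then have "\<not> D dvd t - \<lfloor>snd (?W - p)\<rfloor>"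
          using False by (metis dvd_minus_iff dvd_add_left_iff dvd_triv_left)
        then show ?thesis using False by simp
      qed
    next
      fix p assume "p \<in> box_pts (- V)"
      from box_pts_reflect[OF this] show "?W - p \<in> box_pts V" by simp
    qed simp_all
    also have "\<dots> = (-1) ^ (n - 1) * F (- V) t"
      by (simp only: F_def sum_distrib_left)
    also have "F (- V) t = real (card (cone_pts c [] (- V) t))"
      unfolding F_def n_def
      by (rule card_cone_pts_equal_heights[symmetric]) (use off_walls_uminus off V t height in auto)
    finally show ?thesis .
  qed
  ultimately show ?thesis
    unfolding reciprocal_def n_def by blast
qed

end

lemma zero_less_mult_pos_iff: "(r::real) > 0 \<Longrightarrow> 0 < r * x \<longleftrightarrow> 0 < x"
  by (simp add: zero_less_mult_iff)

text \<open>Multiplying each generator by the product of the heights of all the others gives every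
  generator the product of all heights. Positive scaling of generators and coordinates leaves the
  cone unchanged.\<close>

lemma simplicial_cone_rescale:
  assumes "simplicial_cone w c"
  obtains w' c' D where "simplicial_cone w' c'" "\<And>i. snd (w' i) = of_int D"
    "\<And>i. \<exists>r>0. \<forall>y. c' i y = r * c i y"
proof -
  interpret simplicial_cone w c by (rule assms)
  define T where "T i = \<lfloor>snd (w i)\<rfloor>" for i
  have T: "snd (w i) = of_int (T i)" for i
    using w_lat[of i] by (auto simp: T_def lat_def elim: Ints_cases)
  have T_pos: "T i > 0" for i
    using height_pos[of i] by (simp add: T)
  define q where "q i = (\<Prod>j\<in>UNIV - {i}. T j)" for i
  have q_pos: "q i > 0" for i
    unfolding q_def by (intro prod_pos) (auto simp: T_pos)
  have qT: "q i * T i = (\<Prod>j\<in>UNIV. T j)" for i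
    using prod.remove[of UNIV i T] by (simp add: q_def mult.commute)
  define w' where "w' i = of_int (q i) *\<^sub>R w i" for i
  define c' where "c' i y = (1 / of_int (q i)) * c i y" for i y
  show ?thesis
  proof
    show "simplicial_cone w' c'"
    proof (rule simplicial_cone.intro)
      show "w' i \<in> lat" for i
        unfolding w'_def by (intro lat_scaleR w_lat) auto
      show "0 < snd (w' i)" for i
        using q_pos height_pos by (simp add: w'_def)
      show "linear (c' i)" for i
        unfolding c'_def using linear_compose_scale_right[OF lin[of i], of "1 / of_int (q i)"]
        by simp
      show "c' i y \<in> \<rat>" if "y \<in> lat" for i y
        unfolding c'_def using rat[OF that, of i] by auto
      show "c' i (w' j) = (if i = j then 1 else 0)" for i j
        using q_pos[of j] by (simp add: c'_def w'_def linear_scale[OF lin] dual)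
      show "(\<Sum>i\<in>UNIV. c' i y *\<^sub>R w' i) = y" for y
      proof -
        have "c' i y *\<^sub>R w' i = c i y *\<^sub>R w i" for i
          using q_pos[of i] by (simp add: c'_def w'_def)
        then show ?thesis using expand[of y] by simp
      qed
    qed
    show "snd (w' i) = of_int (\<Prod>j\<in>UNIV. T j)" for i
      unfolding qT[of i, symmetric] by (simp add: w'_def T)
    show "\<exists>r>0. \<forall>y. c' i y = r * c i y" for i
      using q_pos[of i] by (auto simp: c'_def intro!: exI[of _ "1 / of_int (q i)"])
  qed
qed

lemma reciprocal_simplicial_cone:
  fixes w :: "'n::finite \<Rightarrow> (real^'d) \<times> real"
  assumes "simplicial_cone w c" "off_walls c V" "snd V = 0"
  shows "reciprocal (CARD('n) - 1) (\<lambda>t. card (cone_pts c [] V t)) (\<lambda>t. card (cone_pts c [] (- V) t))"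
proof -
  obtain w' c' D where w': "simplicial_cone w' c'" "\<And>i. snd (w' i) = of_int D"
    and pos: "\<And>i. \<exists>r>0. \<forall>y. c' i y = r * c i y"
    using simplicial_cone_rescale[OF assms(1)] by metis
  obtain r where r: "\<And>i. r i > 0" "\<And>i y. c' i y = r i * c i y"
    using pos by metis
  have "r i \<noteq> 0" for i :: 'n
    using r(1)[of i] by simp
  then have "off_walls c' V"
    using assms(2) by (simp add: off_walls_def r(2))
  moreover have "cone_pts c' [] U t = cone_pts c [] U t" for U t
    using r(1) by (simp add: cone_pts_def r(2) zero_less_mult_pos_iff)
  ultimately show ?thesis
    using simplicial_cone.reciprocal_equal_heights[OF w'(1) _ assms(3) w'(2)] by simp
qed

subsection \<open>Cutting simplicial cones by half-spaces\<close>

text \<open>Equivalently, 1 and the coordinates of \<open>v\<close> are linearly independent over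
  the rationals.\<close>

definition generic :: "real^'d \<Rightarrow> bool" where
  "generic v \<longleftrightarrow> (\<forall>r. r \<noteq> 0 \<longrightarrow> (\<forall>j. r $ j \<in> \<rat>) \<longrightarrow> r \<bullet> v \<notin> \<rat>)"

text \<open>The vectors that are not generic lie on countably many hyperplanes with rational data, a
  set of measure zero.\<close>

lemma generic_dense:
  fixes S :: "(real^'d) set"
  assumes "open S" "S \<noteq> {}"
  shows "\<exists>v\<in>S. generic v"
proof -
  let ?R = "{r::real^'d. r \<noteq> 0 \<and> (\<forall>j. r $ j \<in> \<rat>)}"
  have "?R \<subseteq> range (\<lambda>q::rat^'d. \<chi> j. of_rat (q $ j))"
  proof
    fix r assume "r \<in> ?R"
    then obtain f where "\<And>j. r $ j = of_rat (f j)"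
      unfolding Rats_def by (auto simp: image_iff) metis
    then have "r = (\<chi> j. of_rat ((\<chi> j. f j) $ j))"
      by (simp add: vec_eq_iff)
    then show "r \<in> range (\<lambda>q::rat^'d. \<chi> j. of_rat (q $ j))"
      by (rule range_eqI)
  qed
  then have "countable ?R"
    by (rule countable_subset) auto
  then have "countable (?R \<times> (\<rat> :: real set))"
    by (intro countable_SIGMA countable_rat)
  then have "negligible (\<Union>((\<lambda>(r, s). {v. r \<bullet> v = s}) ` (?R \<times> \<rat>)))"
    by (intro negligible_countable_Union) (auto intro: negligible_hyperplane)
  moreover have "\<not> negligible S"
    using assms by (rule open_not_negligible)
  ultimately have "\<not> S \<subseteq> \<Union>((\<lambda>(r, s). {v. r \<bullet> v = s}) ` (?R \<times> \<rat>))"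
    using negligible_subset by blast
  then obtain v where "v \<in> S" "v \<notin> \<Union>((\<lambda>(r, s). {v. r \<bullet> v = s}) ` (?R \<times> \<rat>))"
    by blast
  then show ?thesis
    unfolding generic_def by (intro bexI[of _ v]) auto
qed

text \<open>A lattice point on a wall gives a rational vector \<open>r\<close>, the restriction of
  \<open>c i\<close> to height 0, with \<open>r\<close> times \<open>v\<close> rational. Genericity
  forces \<open>r = 0\<close>, so \<open>c i\<close> is a multiple of the height. It vanishes on a
  second generator, whose height is positive, hence everywhere, against the value 1 on
  \<open>w i\<close>; the second generator exists by \<open>CARD('n) \<ge> 2\<close>.\<close>

lemma generic_off_walls:
  fixes w :: "'n::finite \<Rightarrow> (real^'d) \<times> real"
  assumes "simplicial_cone w c" and gen: "generic v" and two: "CARD('n) \<ge> 2"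
  shows "off_walls c (v, 0)"
  unfolding off_walls_def
proof (intro ballI allI notI)
  interpret simplicial_cone w c by (rule assms(1))
  fix y :: "(real^'d) \<times> real" and i
  assume y: "y \<in> lat" and zero: "c i (y - (v, 0)) = 0"
  define r where "r = (\<chi> j. c i (axis j 1, 0))"
  have inner: "c i (x, 0) = r \<bullet> x" for x
  proof -
    have "(x, 0::real) = (\<Sum>j\<in>UNIV. x $ j *\<^sub>R (axis j 1, 0))"
      using basis_expansion[of x]
      by (simp add: prod_eq_iff fst_sum snd_sum scalar_mult_eq_scaleR)
    then have "c i (x, 0) = (\<Sum>j\<in>UNIV. x $ j * c i (axis j 1, 0))"
      using linear_sum[OF lin, of i "\<lambda>j. x $ j *\<^sub>R (axis j 1, 0)" UNIV]
      by (simp add: linear_scale[OF lin] del: scaleR_Pair)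
    then show ?thesis
      by (simp add: r_def inner_vec_def mult.commute)
  qed
  have "r $ j \<in> \<rat>" for j
    unfolding r_def by (auto simp: lat_def lattice_pts_def axis_def intro!: rat)
  moreover have "r \<bullet> v \<in> \<rat>"
    using zero rat[OF y, of i] linear_diff[OF lin, of i y "(v, 0)"] by (simp add: inner)
  ultimately have r0: "r = 0"
    using gen by (auto simp: generic_def)
  have vert: "c i z = snd z * c i (0, 1)" for z
  proof -
    have "z = (fst z, 0) + snd z *\<^sub>R (0, 1)"
      by (simp add: prod_eq_iff)
    then have "c i z = c i (fst z, 0) + snd z * c i (0, 1)"
      using linear_add[OF lin] linear_scale[OF lin] by (metis real_scaleR_def)
    then show ?thesis by (simp add: inner r0)
  qed
  have "\<exists>j::'n. j \<noteq> i"
  proof (rule ccontr)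
    assume "\<not> ?thesis"
    then have "UNIV = {i}" by auto
    then have "CARD('n) = card {i}" by simp
    then show False using two by simp
  qed
  then obtain j where "j \<noteq> i" by blast
  then have "c i (0, 1) = 0"
    using vert[of "w j"] dual[of i j] height_pos[of j] by simp
  then show False
    using vert[of "w i"] dual[of i i] by simp
qed

text \<open>Elliott's reduction step: replacing \<open>w\<^sub>q\<close> by the combination of \<open>w\<^sub>p\<close> and \<open>w\<^sub>q\<close> that lies on
  the cutting hyperplane.\<close>

lemma simplicial_cone_split:
  assumes "simplicial_cone w c" and pq: "p \<noteq> q" and \<alpha>: "\<alpha> \<in> \<int>" "\<alpha> > 0" and \<beta>: "\<beta> \<in> \<int>" "\<beta> < 0"
  shows "simplicial_cone (w(q := \<alpha> *\<^sub>R w q - \<beta> *\<^sub>R w p))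
    (c(p := \<lambda>y. c p y + c q y * (\<beta> / \<alpha>), q := \<lambda>y. c q y / \<alpha>))"
    (is "simplicial_cone ?w ?c")
proof -
  interpret simplicial_cone w c by (rule assms(1))
  have rats: "\<alpha> \<in> \<rat>" "\<beta> \<in> \<rat>"
    using \<alpha> \<beta> Ints_subset_Rats by auto
  show ?thesis
  proof (rule simplicial_cone.intro)
    show "?w i \<in> lat" for i
      using \<alpha> \<beta> by (auto intro: w_lat lat_diff lat_scaleR)
    show "0 < snd (?w i)" for i
    proof -
      have "0 < \<alpha> * snd (w q)" "\<beta> * snd (w p) < 0"
        using \<alpha> \<beta> height_pos by (auto simp: mult_neg_pos)
      then show ?thesis by (auto simp: height_pos)
    qed
    show "linear (?c i)" for i
      by (rule linearI)
        (auto simp: linear_add[OF lin] linear_scale[OF lin] add_divide_distrib algebra_simps)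
    show "?c i y \<in> \<rat>" if "y \<in> lat" for i y
      using rat[OF that] rats by auto
    show "?c i (?w j) = (if i = j then 1 else 0)" for i j
      using pq \<alpha> by (auto simp: linear_diff[OF lin] linear_scale[OF lin] dual)
    show "(\<Sum>i\<in>UNIV. ?c i y *\<^sub>R ?w i) = y" for y
    proof -
      have split: "(\<Sum>i\<in>UNIV. f i) = f p + (f q + (\<Sum>i\<in>UNIV - {p} - {q}. f i))"
        for f :: "_ \<Rightarrow> (real^_) \<times> real"
        using pq by (simp add: sum.remove[of UNIV p] sum.remove[of "UNIV - {p}" q])
      have "(\<Sum>i\<in>UNIV. ?c i y *\<^sub>R ?w i) = (c p y + c q y * (\<beta> / \<alpha>)) *\<^sub>R w p +
          ((c q y / \<alpha>) *\<^sub>R (\<alpha> *\<^sub>R w q - \<beta> *\<^sub>R w p) + (\<Sum>i\<in>UNIV - {p} - {q}. c i y *\<^sub>R w i))"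
        unfolding split using pq by simp
      also have "\<dots> = c p y *\<^sub>R w p + (c q y *\<^sub>R w q + (\<Sum>i\<in>UNIV - {p} - {q}. c i y *\<^sub>R w i))"
        using \<alpha> by (simp add: scaleR_add_left scaleR_diff_right)
      also have "\<dots> = (\<Sum>i\<in>UNIV. c i y *\<^sub>R w i)"
        by (rule split[symmetric])
      finally show ?thesis by (simp only: expand)
    qed
  qed
qed

text \<open>The sign of \<alpha> \<open>c p\<close> + \<beta> \<open>c q\<close> decides the piece.
  Divided by \<alpha> this expression is the coordinate \<open>p\<close> of the first cone, divided
  by \<beta> the coordinate \<open>q\<close> of the second. Its zero set is the new wall, which
  carries no lattice points by \<open>off\<close>.\<close>

lemma card_cone_pts_split:
  assumes "simplicial_cone w c" and pq: "p \<noteq> q" and \<alpha>: "\<alpha> > 0" and \<beta>: "\<beta> < 0" and U: "snd U = 0"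
    and off: "off_walls (c(p := \<lambda>y. c p y + c q y * (\<beta> / \<alpha>), q := \<lambda>y. c q y / \<alpha>)) U"
  shows "card (cone_pts c hs U t) =
    card (cone_pts (c(p := \<lambda>y. c p y + c q y * (\<beta> / \<alpha>), q := \<lambda>y. c q y / \<alpha>)) hs U t) +
    card (cone_pts (c(q := \<lambda>y. c q y + c p y * (- \<alpha> / - \<beta>), p := \<lambda>y. c p y / - \<beta>)) hs U t)"
    (is "_ = card (cone_pts ?c1 hs U t) + card (cone_pts ?c2 hs U t)")
proof -
  interpret simplicial_cone w c by (rule assms(1))
  let ?A = "\<lambda>y. \<alpha> * c p y + \<beta> * c q y"
  let ?rest = "\<lambda>y. \<forall>i. i \<noteq> p \<longrightarrow> i \<noteq> q \<longrightarrow> 0 < c i y"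
  have all_split: "(\<forall>i. Q i) \<longleftrightarrow> Q p \<and> Q q \<and> (\<forall>i. i \<noteq> p \<longrightarrow> i \<noteq> q \<longrightarrow> Q i)" for Q
    by metis
  have c1: "(\<forall>i. 0 < ?c1 i y) \<longleftrightarrow> 0 < ?A y \<and> 0 < c q y \<and> ?rest y" for y
  proof -
    have "?c1 p y = ?A y / \<alpha>"
      using pq \<alpha> by (simp add: field_simps)
    then have "0 < ?c1 p y \<longleftrightarrow> 0 < ?A y"
      using \<alpha> by (simp add: zero_less_divide_iff)
    then show ?thesis
      using pq \<alpha> by (subst all_split) (simp add: zero_less_divide_iff)
  qed
  have c2: "(\<forall>i. 0 < ?c2 i y) \<longleftrightarrow> 0 < c p y \<and> ?A y < 0 \<and> ?rest y" for y
  proof -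
    have "?c2 q y = ?A y / \<beta>"
      using pq \<beta> by (simp add: field_simps)
    then have "0 < ?c2 q y \<longleftrightarrow> ?A y < 0"
      using \<beta> by (simp add: zero_less_divide_iff)
    moreover have "0 < ?c2 p y \<longleftrightarrow> 0 < c p y"
      using pq \<beta> by (simp add: divide_less_0_iff)
    ultimately show ?thesis
      using pq by (subst all_split) auto
  qed
  have c: "(\<forall>i. 0 < c i y) \<longleftrightarrow> 0 < c p y \<and> 0 < c q y \<and> ?rest y" for y
    by (rule all_split)
  have pos_p: "0 < c p y" if "0 < ?A y" "0 < c q y" for y
    using that mult_neg_pos[OF \<beta> that(2)] \<alpha> by (smt (verit) zero_less_mult_pos)
  have pos_q: "0 < c q y" if "0 < c p y" "?A y < 0" for y
  proof (rule ccontr)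
    assume "\<not> 0 < c q y"
    then have "0 \<le> \<beta> * c q y"
      using \<beta> by (simp add: mult_nonpos_nonpos)
    moreover have "0 < \<alpha> * c p y"
      using \<alpha> that(1) by simp
    ultimately show False using that(2) by simp
  qed
  have nonzero: "?A (y - U) \<noteq> 0" if "y \<in> lat" for y
  proof -
    have "?c1 p (y - U) \<noteq> 0"
      using off that by (auto simp: off_walls_def)
    moreover have "?c1 p (y - U) = ?A (y - U) / \<alpha>"
      using pq \<alpha> by (simp add: field_simps)
    ultimately show ?thesis by auto
  qed
  have "cone_pts c hs U t = cone_pts ?c1 hs U t \<union> cone_pts ?c2 hs U t" (is "?L = ?R1 \<union> ?R2")
  proof (rule set_eqI)
    fix y
    have "(\<forall>i. 0 < c i (y - U)) \<longleftrightarrow> (\<forall>i. 0 < ?c1 i (y - U)) \<or> (\<forall>i. 0 < ?c2 i (y - U))" if "y \<in> lat"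
      unfolding c c1 c2 using pos_p[of "y - U"] pos_q[of "y - U"] nonzero[OF that]
      by (meson linorder_neqE_linordered_idom)
    then show "y \<in> ?L \<longleftrightarrow> y \<in> ?R1 \<union> ?R2"
      unfolding cone_pts_def by blast
  qed
  moreover have "?R1 \<inter> ?R2 = {}"
    unfolding cone_pts_def c1 c2 by fastforce
  moreover have "finite ?L"
    using U by (rule finite_cone_pts)
  ultimately show ?thesis
    by (simp add: card_Un_disjoint)
qed

text \<open>The outer induction removes half-spaces; the inner one counts generators off the
  hyperplane of \<open>h\<close>. A split moves one more generator of each piece onto that
  hyperplane and keeps \<open>h\<close> in the list. Once no two generators lie strictly on opposite
  sides, \<open>h\<close> is either positive on the whole open cone or positive nowhere on
  it.\<close>

lemma reciprocal_cut_simplicial_cone: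
  fixes w :: "'n::finite \<Rightarrow> (real^'d) \<times> real"
  assumes "simplicial_cone w c" and gen: "generic v" and two: "CARD('n) \<ge> 2"
    and "\<And>h. h \<in> set hs \<Longrightarrow> linear h \<and> (\<forall>y\<in>lat. h y \<in> \<int>) \<and> (\<exists>y. h y \<noteq> 0)"
  shows "reciprocal (CARD('n) - 1) (\<lambda>t. card (cone_pts c hs (v, 0) t))
    (\<lambda>t. card (cone_pts c hs (- (v, 0)) t))"
  using assms(1,4)
proof (induction hs arbitrary: w c)
  case Nil
  then show ?case
    using gen two by (intro reciprocal_simplicial_cone generic_off_walls) auto
next
  case (Cons h hs)
  have h: "linear h" "\<And>y. y \<in> lat \<Longrightarrow> h y \<in> \<int>" "\<exists>y. h y \<noteq> 0"
    using Cons.prems(2)[of h] by auto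
  have IH: "reciprocal (CARD('n) - 1) (\<lambda>t. card (cone_pts c hs (v, 0) t))
    (\<lambda>t. card (cone_pts c hs (- (v, 0)) t))" if "simplicial_cone w c"
    for w :: "'n \<Rightarrow> (real^'d) \<times> real" and c
    using Cons.IH[OF that] Cons.prems(2) by simp
  show ?case using Cons.prems(1)
  proof (induction "card {i. h (w i) \<noteq> 0}" arbitrary: w c rule: less_induct)
    case less
    interpret simplicial_cone w c by (rule less.prems)
    have h_expand: "h y = (\<Sum>i\<in>UNIV. c i y * h (w i))" for y
      using linear_sum[OF h(1), of "\<lambda>i. c i y *\<^sub>R w i" UNIV]
      by (simp add: expand linear_scale[OF h(1)])
    \<comment> \<open>The generators span, so a nonzero \<open>h\<close> cannot vanish on all of
      them. This yields strict positivity on the open cone when no generator is on the negative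
      side.\<close>
    obtain i0 where i0: "h (w i0) \<noteq> 0"
    proof (rule ccontr)
      assume "\<not> thesis"
      then have zero: "h (w i) = 0" for i using that by blast
      have "h y = 0" for y
        by (subst h_expand) (simp add: zero)
      then show False using h(3) by blast
    qed
    consider (mixed) p q where "h (w p) > 0" "h (w q) < 0"
      | (nonneg) "\<And>i. h (w i) \<ge> 0" | (nonpos) "\<And>i. h (w i) \<le> 0"
      by (meson linorder_not_less)
    then show ?case
    proof cases
      case mixed
      define \<alpha> \<beta> where "\<alpha> = h (w p)" and "\<beta> = h (w q)"
      have \<alpha>: "\<alpha> \<in> \<int>" "\<alpha> > 0" and \<beta>: "\<beta> \<in> \<int>" "\<beta> < 0"
        using mixed h(2) w_lat by (auto simp: \<alpha>_def \<beta>_def)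
      have pq: "p \<noteq> q" using mixed by auto
      define w1 where "w1 = w(q := \<alpha> *\<^sub>R w q - \<beta> *\<^sub>R w p)"
      define c1 where "c1 = c(p := \<lambda>y. c p y + c q y * (\<beta> / \<alpha>), q := \<lambda>y. c q y / \<alpha>)"
      \<comment> \<open>The second piece is the first with \<open>p\<close> and \<open>q\<close>
        exchanged and \<open>- \<beta>\<close>, \<open>- \<alpha>\<close> in the roles of \<alpha>,
        \<beta>, which keeps the required signs.\<close>
      define w2 where "w2 = w(p := - \<beta> *\<^sub>R w p - - \<alpha> *\<^sub>R w q)"
      define c2 where "c2 = c(q := \<lambda>y. c q y + c p y * (- \<alpha> / - \<beta>), p := \<lambda>y. c p y / - \<beta>)"
      have cone1: "simplicial_cone w1 c1"
        unfolding w1_def c1_def using less.prems pq \<alpha> \<beta> by (rule simplicial_cone_split)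
      have cone2: "simplicial_cone w2 c2"
        unfolding w2_def c2_def using less.prems pq \<alpha> \<beta>
        by (intro simplicial_cone_split) auto
      have off: "off_walls c1 (v, 0)"
        using cone1 gen two by (rule generic_off_walls)
      have off': "off_walls c1 (- (v, 0))"
        using cone1 off by (rule simplicial_cone.off_walls_uminus)
      have "h (\<alpha> *\<^sub>R w q - \<beta> *\<^sub>R w p) = 0" "h (- \<beta> *\<^sub>R w p - - \<alpha> *\<^sub>R w q) = 0"
        by (simp_all add: linear_diff[OF h(1)] linear_scale[OF h(1)] linear_neg[OF h(1)]
            linear_add[OF h(1)] \<alpha>_def \<beta>_def)
      then have "{i. h (w1 i) \<noteq> 0} = {i. h (w i) \<noteq> 0} - {q}" "{i. h (w2 i) \<noteq> 0} = {i. h (w i) \<noteq> 0} - {p}"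
        unfolding w1_def w2_def by auto
      moreover have "card ({i. h (w i) \<noteq> 0} - {q}) < card {i. h (w i) \<noteq> 0}"
        "card ({i. h (w i) \<noteq> 0} - {p}) < card {i. h (w i) \<noteq> 0}"
        by (rule card_Diff1_less; use mixed in simp)+
      ultimately have card: "card {i. h (w1 i) \<noteq> 0} < card {i. h (w i) \<noteq> 0}"
        "card {i. h (w2 i) \<noteq> 0} < card {i. h (w i) \<noteq> 0}"
        by simp_all
      have "reciprocal (CARD('n) - 1)
        (\<lambda>t. card (cone_pts c1 (h # hs) (v, 0) t) + card (cone_pts c2 (h # hs) (v, 0) t))
        (\<lambda>t. card (cone_pts c1 (h # hs) (- (v, 0)) t) + card (cone_pts c2 (h # hs) (- (v, 0)) t))"
        using less.hyps[OF card(1) cone1] less.hyps[OF card(2) cone2] by (rule reciprocal_add)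
      moreover have "card (cone_pts c (h # hs) (v, 0) t) =
          card (cone_pts c1 (h # hs) (v, 0) t) + card (cone_pts c2 (h # hs) (v, 0) t)" for t
        unfolding c1_def c2_def
        by (rule card_cone_pts_split[OF less.prems pq \<alpha>(2) \<beta>(2) _ off[unfolded c1_def]]) simp
      moreover have "card (cone_pts c (h # hs) (- (v, 0)) t) =
          card (cone_pts c1 (h # hs) (- (v, 0)) t) + card (cone_pts c2 (h # hs) (- (v, 0)) t)" for t
        unfolding c1_def c2_def
        by (rule card_cone_pts_split[OF less.prems pq \<alpha>(2) \<beta>(2) _ off'[unfolded c1_def]]) simp
      ultimately show ?thesis by simp
    next
      case nonneg
      have "cone_pts c (h # hs) U t = cone_pts c hs U t" for U t
      proof -
        have "0 < h (y - U)" if "\<forall>i. 0 < c i (y - U)" for y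
        proof -
          have "0 < c i0 (y - U) * h (w i0)"
            using that nonneg[of i0] i0 by (simp add: order_less_le)
          also have "\<dots> \<le> (\<Sum>i\<in>UNIV. c i (y - U) * h (w i))"
            using that nonneg by (intro member_le_sum) (auto simp: less_imp_le)
          also have "\<dots> = h (y - U)" by (rule h_expand[symmetric])
          finally show ?thesis .
        qed
        then show ?thesis by (auto simp: cone_pts_def)
      qed
      then show ?thesis using IH[OF less.prems] by simp
    next
      case nonpos
      have "cone_pts c (h # hs) U t = {}" for U t
      proof -
        have "h (y - U) \<le> 0" if "\<forall>i. 0 < c i (y - U)" for y
          using that nonpos
          by (subst h_expand, intro sum_nonpos mult_nonneg_nonpos) (auto simp: less_imp_le)
        then show ?thesis by (force simp: cone_pts_def)
      qed
      then show ?thesis by (simp add: reciprocal_0)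
    qed
  qed
qed

subsection \<open>Translated dilates of polytopes\<close>

lemma sum_UNIV_option: "(\<Sum>i\<in>UNIV. f i) = f None + (\<Sum>k\<in>(UNIV :: 'a::finite set). f (Some k))"
  by (simp add: UNIV_option_conv sum.reindex)

text \<open>The cone over a simplex \<open>{x. x\<^sub>j \<ge> - M, \<Sum>\<^sub>j (x\<^sub>j + M) \<le> N}\<close> that contains the given set in
  its interior.\<close>

lemma simplicial_cone_over_bounded:
  fixes P :: "(real^'d) set"
  assumes "bounded P"
  obtains w :: "'d option \<Rightarrow> (real^'d) \<times> real" and c where "simplicial_cone w c"
    "\<And>x t i. x \<in> P \<Longrightarrow> t > 0 \<Longrightarrow> 0 < c i (t *\<^sub>R x, t)"
proof -
  obtain B where B: "\<And>x. x \<in> P \<Longrightarrow> norm x \<le> B"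
    using assms by (auto simp: bounded_iff)
  \<comment> \<open>The maximum with 1 keeps \<open>M\<close> positive whatever bound
    \<open>B\<close> was obtained.\<close>
  define M where "M = real_of_int (max 1 (\<lceil>B\<rceil> + 1))"
  have M: "M \<in> \<int>" "M > 0" "B < M"
    unfolding M_def by (simp, simp, linarith)
  \<comment> \<open>Each \<open>x $ k + M\<close> is below \<open>2 * M\<close> on \<open>P\<close>,
    so with this \<open>N\<close> the coordinates \<open>b\<close> of points at height 1 sum to less
    than 1.\<close>
  define N where "N = 2 * M * real CARD('d)"
  have N: "N \<in> \<int>" "N > 0"
    using M by (auto simp: N_def)
  \<comment> \<open>The vertices of the simplex at height 1: \<open>None\<close> is the corner with
    all entries \<open>- M\<close>, and \<open>c\<close> collects the homogenized barycentric
    coordinates.\<close>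
  define w :: "'d option \<Rightarrow> (real^'d) \<times> real" where
    "w i = ((\<chi> j. - M + (if i = Some j then N else 0)), 1)" for i
  define b where "b y k = (fst y $ k + M * snd y) / N" for y :: "(real^'d) \<times> real" and k
  define c where "c i y = (case i of None \<Rightarrow> snd y - (\<Sum>k\<in>UNIV. b y k) | Some k \<Rightarrow> b y k)" for i y
  have b_w: "b (w i) k = (if i = Some k then 1 else 0)" for i k
    using N by (simp add: b_def w_def)
  have snd_w: "snd (w i) = 1" for i
    by (simp add: w_def)
  have rats: "M \<in> \<rat>" "N \<in> \<rat>"
    using M N Ints_subset_Rats by auto
  have b_rat: "b y k \<in> \<rat>" if "y \<in> lat" for y k
  proof -
    have "fst y $ k \<in> \<rat>" "snd y \<in> \<rat>"
      using that Ints_subset_Rats by (auto simp: lat_def lattice_pts_def)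
    then show ?thesis
      using rats by (auto simp: b_def)
  qed
  show ?thesis
  proof
    show "simplicial_cone w c"
    proof (rule simplicial_cone.intro)
      show "w i \<in> lat" for i
        using M N by (auto simp: w_def lat_def lattice_pts_def)
      show "0 < snd (w i)" for i
        by (simp add: snd_w)
      have b_add: "b (x + y) k = b x k + b y k" for x y k
        by (simp add: b_def add_divide_distrib algebra_simps)
      have b_scale: "b (r *\<^sub>R x) k = r * b x k" for r x k
        by (simp add: b_def add_divide_distrib algebra_simps)
      show "linear (c i)" for i
        by (rule linearI)
          (auto simp: c_def b_add b_scale sum.distrib sum_distrib_left algebra_simps split: option.split)
      show "c i y \<in> \<rat>" if "y \<in> lat" for i y
      proof -
        have "snd y \<in> \<rat>"
          using that Ints_subset_Rats by (auto simp: lat_def)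
        moreover have "(\<Sum>k\<in>UNIV. b y k) \<in> \<rat>"
          using b_rat[OF that] by (intro Rats_sum) auto
        ultimately show ?thesis
          using b_rat[OF that] by (auto simp: c_def split: option.split)
      qed
      show "c i (w j) = (if i = j then 1 else 0)" for i j
        by (cases i; cases j) (auto simp: c_def b_w snd_w)
      show "(\<Sum>i\<in>UNIV. c i y *\<^sub>R w i) = y" for y
      proof (rule prod_eqI)
        have tot: "(\<Sum>i\<in>UNIV. c i y) = snd y"
          by (simp add: sum_UNIV_option c_def)
        show "snd (\<Sum>i\<in>UNIV. c i y *\<^sub>R w i) = snd y"
          using tot by (simp add: snd_sum snd_w)
        show "fst (\<Sum>i\<in>UNIV. c i y *\<^sub>R w i) = fst y"
        proof (rule vec_eq_iff[THEN iffD2], rule allI)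
          fix j
          have "fst (\<Sum>i\<in>UNIV. c i y *\<^sub>R w i) $ j
              = (\<Sum>i\<in>UNIV. - M * c i y + (if i = Some j then c i y * N else 0))"
            by (simp add: fst_sum w_def algebra_simps if_distrib cong: if_cong)
          also have "\<dots> = - M * (\<Sum>i\<in>UNIV. c i y) + c (Some j) y * N"
            by (simp only: sum.distrib sum_distrib_left) simp
          also have "\<dots> = - M * snd y + c (Some j) y * N"
            by (simp only: tot)
          also have "\<dots> = fst y $ j"
            using N by (simp add: c_def b_def)
          finally show "fst (\<Sum>i\<in>UNIV. c i y *\<^sub>R w i) $ j = fst y $ j" .
        qed
      qed
    qed
    show "0 < c i (t *\<^sub>R x, t)" if x: "x \<in> P" and t: "t > 0" for x t i
    proof -
      have x_lt: "- M < x $ k" "x $ k < M" for k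
        using component_le_norm_cart[of x k] B[OF x] M by linarith+
      have b_eq: "b (t *\<^sub>R x, t) k = t * ((x $ k + M) / N)" for k
        by (simp add: b_def algebra_simps add_divide_distrib)
      have "(\<Sum>k\<in>UNIV. (x $ k + M) / N) < (\<Sum>k\<in>(UNIV :: 'd set). 2 * M / N)"
      proof (intro sum_strict_mono divide_strict_right_mono)
        show "x $ k + M < 2 * M" for k
          using x_lt(2)[of k] by linarith
      qed (use N in auto)
      also have "\<dots> = 1"
        using N M(2) by (simp add: N_def)
      finally have "t * (\<Sum>k\<in>UNIV. (x $ k + M) / N) < t * 1"
        using t by (intro mult_strict_left_mono)
      then have "(\<Sum>k\<in>UNIV. b (t *\<^sub>R x, t) k) < t"
        by (simp add: b_eq sum_distrib_left)
      moreover have "0 < b (t *\<^sub>R x, t) k" for k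
      proof -
        have "0 < x $ k + M" using x_lt(1)[of k] by linarith
        then show ?thesis using t N by (simp add: b_eq)
      qed
      ultimately show ?thesis
        by (auto simp: c_def split: option.split)
    qed
  qed
qed

section \<open>Lattice points of translated dilates\<close>

lemma int_vec_inner_lattice_pts: "x \<in> lattice_pts \<Longrightarrow> int_vec a \<bullet> x \<in> \<int>"
  by (auto simp: int_vec_def lattice_pts_def inner_vec_def intro!: Ints_sum)

lemma translated_dilate_lattice_pts:
  fixes v :: "real^'d" and t :: int
  assumes P: "P = ineq_set m a b" and t: "t \<ge> 1"
  shows "(\<lambda>p. of_int t *\<^sub>R p + v) ` P \<inter> lattice_pts =
    {x \<in> lattice_pts. \<forall>i<m. int_vec (a i) \<bullet> v \<le> int_vec (a i) \<bullet> x - of_int (b i) * of_int t}"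
proof (intro set_eqI iffI)
  fix x assume "x \<in> (\<lambda>p. of_int t *\<^sub>R p + v) ` P \<inter> lattice_pts"
  then obtain p where p: "p \<in> P" "x = of_int t *\<^sub>R p + v" "x \<in> lattice_pts" by blast
  have "of_int (b i) * of_int t \<le> (int_vec (a i) \<bullet> p) * of_int t" if "i < m" for i
    using p(1) that t by (intro mult_right_mono) (auto simp: P ineq_set_def)
  then show "x \<in> {x \<in> lattice_pts. \<forall>i<m. int_vec (a i) \<bullet> v \<le> int_vec (a i) \<bullet> x - of_int (b i) * of_int t}"
    using p by (auto simp: inner_add_right algebra_simps)
next
  fix x
  assume x: "x \<in> {x \<in> lattice_pts. \<forall>i<m. int_vec (a i) \<bullet> v \<le> int_vec (a i) \<bullet> x - of_int (b i) * of_int t}"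
  define p where "p = (1 / of_int t) *\<^sub>R (x - v)"
  have "x = of_int t *\<^sub>R p + v"
    using t by (simp add: p_def)
  moreover have "p \<in> P"
    using x t by (auto simp: P ineq_set_def p_def inner_diff_right field_simps)
  ultimately show "x \<in> (\<lambda>p. of_int t *\<^sub>R p + v) ` P \<inter> lattice_pts"
    using x by blast
qed

text \<open>At a lattice point the right-hand side of each inequality is an integer, so
  \<open>v\<close> enters only through the ceilings.\<close>

lemma TL_eq_if_ceiling_eq:
  fixes t :: int
  assumes P: "P = ineq_set m a b" and t: "t \<ge> 1"
    and "\<And>i. i < m \<Longrightarrow> \<lceil>int_vec (a i) \<bullet> v\<rceil> = \<lceil>int_vec (a i) \<bullet> v'\<rceil>"
  shows "TL P v (of_int t) = TL P v' (of_int t)"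
proof -
  have "int_vec (a i) \<bullet> v \<le> int_vec (a i) \<bullet> x - of_int (b i) * of_int t \<longleftrightarrow>
      int_vec (a i) \<bullet> v' \<le> int_vec (a i) \<bullet> x - of_int (b i) * of_int t"
    if i: "i < m" and x: "x \<in> lattice_pts" for i x
  proof -
    obtain s where "int_vec (a i) \<bullet> x - of_int (b i) * of_int t = of_int s"
      using int_vec_inner_lattice_pts[OF x, of "a i"] by (auto elim!: Ints_cases) (metis of_int_diff of_int_mult)
    then show ?thesis
      using assms(3)[OF i] by (simp add: ceiling_le_iff[symmetric])
  qed
  then show ?thesis
    unfolding TL_def translated_dilate_lattice_pts[OF P t] by (intro arg_cong[where f = card]) blast
qed

text \<open>The involution \<open>?f\<close> turns \<open>t p + v\<close> into
  \<open>t (- p - u) - v\<close>, and \<open>- p - u\<close> lies in \<open>P\<close> by the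
  symmetry. It preserves the lattice because \<open>t\<close> and \<open>u\<close> are
  integral.\<close>

lemma TL_uminus:
  fixes P :: "(real^'d) set" and t :: int
  assumes "uminus ` P = (\<lambda>x. x + int_vec u) ` P"
  shows "TL P (- v) (of_int t) = TL P v (of_int t)"
proof -
  define X where "X v = (\<lambda>p. of_int t *\<^sub>R p + v) ` P \<inter> lattice_pts" for v :: "real^'d"
  let ?f = "\<lambda>x. - x - of_int t *\<^sub>R int_vec u"
  have P: "- p - int_vec u \<in> P" if "p \<in> P" for p
  proof -
    have "- p \<in> (\<lambda>x. x + int_vec u) ` P"
      using that assms by blast
    then show ?thesis by auto
  qed
  have f: "?f x \<in> X (- v)" if xv: "x \<in> X v" for x v
  proof -
    obtain p where p: "p \<in> P" "x = of_int t *\<^sub>R p + v" and x: "x \<in> lattice_pts"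
      using xv unfolding X_def by blast
    have "?f x = of_int t *\<^sub>R (- p - int_vec u) + - v"
      by (simp add: p scaleR_diff_right)
    moreover have "?f x \<in> lattice_pts"
      using x by (auto simp: lattice_pts_def int_vec_def)
    ultimately show ?thesis
      using P[OF p(1)] by (auto simp: X_def)
  qed
  have "bij_betw ?f (X (- v)) (X v)"
    by (rule bij_betw_byWitness[where f' = ?f]) (use f[of _ v] f[of _ "- v"] in auto)
  then show ?thesis
    unfolding TL_def X_def by (rule bij_betw_same_card)
qed

text \<open>The closed inequalities of \<open>P\<close> compare an integer with a number that is not
  one, so at lattice points they are strict. The inequalities from \<open>c\<close> follow, since
  the simplicial cone contains the cone over \<open>P\<close>.\<close>

lemma TL_eq_card_cone_pts:
  fixes v :: "real^'d" and t :: int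
  assumes P: "P = ineq_set m a b" and t: "t \<ge> 1"
    and c: "\<And>x r i. x \<in> P \<Longrightarrow> r > 0 \<Longrightarrow> 0 < c i (r *\<^sub>R x, r)"
    and v: "\<And>i. i < m \<Longrightarrow> int_vec (a i) \<bullet> v \<notin> \<int>"
  shows "TL P v (of_int t) =
    card (cone_pts c (map (\<lambda>i y. int_vec (a i) \<bullet> fst y - of_int (b i) * snd y) [0..<m]) (v, 0) t)"
    (is "_ = card (cone_pts c ?hs (v, 0) t)")
proof -
  let ?X = "(\<lambda>p. of_int t *\<^sub>R p + v) ` P \<inter> lattice_pts"
  have "cone_pts c ?hs (v, 0) t = (\<lambda>x. (x, real_of_int t)) ` ?X"
  proof (intro set_eqI iffI)
    fix y assume y: "y \<in> cone_pts c ?hs (v, 0) t"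
    obtain x where x: "y = (x, of_int t)"
      using y by (cases y) (auto simp: cone_pts_def)
    have "x \<in> ?X"
      unfolding translated_dilate_lattice_pts[OF P t]
      using y unfolding x by (force simp: cone_pts_def lat_def inner_diff_right)
    then show "y \<in> (\<lambda>x. (x, real_of_int t)) ` ?X"
      by (auto simp: x)
  next
    fix y assume "y \<in> (\<lambda>x. (x, real_of_int t)) ` ?X"
    then obtain x where y: "y = (x, of_int t)" and x: "x \<in> ?X" by blast
    obtain p where p: "p \<in> P" "x = of_int t *\<^sub>R p + v" using x by blast
    have lattice: "x \<in> lattice_pts" using x by blast
    have "y - (v, 0) = (of_int t *\<^sub>R p, of_int t)"
      by (simp add: y p)
    then have "0 < c i (y - (v, 0))" for i
      using c[OF p(1), of "of_int t"] t by simp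
    moreover have "0 < int_vec (a i) \<bullet> fst (y - (v, 0)) - of_int (b i) * snd (y - (v, 0))" if i: "i < m" for i
    proof -
      have "int_vec (a i) \<bullet> v \<le> int_vec (a i) \<bullet> x - of_int (b i) * of_int t"
        using x i unfolding translated_dilate_lattice_pts[OF P t] by blast
      moreover have "int_vec (a i) \<bullet> x - of_int (b i) * of_int t \<in> \<int>"
        using int_vec_inner_lattice_pts[OF lattice] by auto
      ultimately have "int_vec (a i) \<bullet> v < int_vec (a i) \<bullet> x - of_int (b i) * of_int t"
        using v[OF i] by (metis order_le_less)
      then show ?thesis by (simp add: y inner_diff_right)
    qed
    ultimately show "y \<in> cone_pts c ?hs (v, 0) t"
      using lattice by (auto simp: cone_pts_def y lat_def)
  qed
  moreover have "inj_on (\<lambda>x. (x, real_of_int t)) ?X"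
    by (auto intro: inj_onI)
  ultimately show ?thesis
    by (simp add: TL_def card_image)
qed

text \<open>With a zero normal the inequality does not depend on the point; it holds somewhere since
  \<open>P\<close> is nonempty, hence everywhere, and would be redundant.\<close>

lemma normal_nonzero:
  assumes "polytope_rep P m a b" "i < m"
  shows "a i \<noteq> 0"
proof
  assume zero: "a i = 0"
  have P: "P = ineq_set m a b" and irr: "irredundant m a b" and "interior P \<noteq> {}"
    using assms(1) by (auto simp: polytope_rep_def)
  then obtain x where "x \<in> ineq_set m a b"
    using interior_subset by blast
  then have "of_int (b i) \<le> (0::real)"
    using assms(2) zero by (auto simp: ineq_set_def int_vec_def inner_vec_def)
  then have "of_int (b i) \<le> int_vec (a i) \<bullet> y" for y
    by (simp add: zero int_vec_def inner_vec_def)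
  then have "{y. \<forall>j<m. j \<noteq> i \<longrightarrow> int_vec (a j) \<bullet> y \<ge> of_int (b j)} = ineq_set m a b"
    unfolding ineq_set_def by (intro Collect_cong) metis
  then show False
    using irr assms(2) by (auto simp: irredundant_def)
qed

lemma int_vec_eq_0_iff: "int_vec a = 0 \<longleftrightarrow> a = 0"
  by (simp add: int_vec_def vec_eq_iff)

lemma generic_notin_Ints:
  assumes "generic v" "a \<noteq> 0"
  shows "int_vec a \<bullet> v \<notin> \<int>"
proof -
  have "int_vec a $ j \<in> \<rat>" for j
    by (simp add: int_vec_def)
  moreover have "int_vec a \<noteq> 0"
    using assms(2) by (simp add: int_vec_eq_0_iff)
  ultimately have "int_vec a \<bullet> v \<notin> \<rat>"
    using assms(1) unfolding generic_def by blast
  then show ?thesis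
    using Ints_subset_Rats by blast
qed

lemma reciprocal_TL_generic:
  fixes P :: "(real^'d) set"
  assumes rep: "polytope_rep P m a b" and gen: "generic v"
  shows "reciprocal CARD('d) (\<lambda>t. TL P v (of_int t)) (\<lambda>t. TL P (- v) (of_int t))"
proof -
  have P: "P = ineq_set m a b" "bounded P"
    using rep by (auto simp: polytope_rep_def)
  obtain w :: "'d option \<Rightarrow> (real^'d) \<times> real" and c where cone: "simplicial_cone w c"
    and c: "\<And>x r i. x \<in> P \<Longrightarrow> r > 0 \<Longrightarrow> 0 < c i (r *\<^sub>R x, r)"
    using simplicial_cone_over_bounded[OF P(2)] by metis
  have v: "int_vec (a i) \<bullet> v \<notin> \<int>" if "i < m" for i
    using gen normal_nonzero[OF rep that] by (rule generic_notin_Ints)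
  then have v_minus: "int_vec (a i) \<bullet> (- v) \<notin> \<int>" if "i < m" for i
    using that by simp
  let ?h = "\<lambda>i y. int_vec (a i) \<bullet> fst y - of_int (b i) * snd y"
  have h: "linear (?h i) \<and> (\<forall>y\<in>lat. ?h i y \<in> \<int>) \<and> (\<exists>y. ?h i y \<noteq> 0)" if "i < m" for i
  proof (intro conjI ballI)
    show "linear (?h i)"
      by (rule linearI) (simp_all add: inner_add_right algebra_simps)
    show "?h i y \<in> \<int>" if "y \<in> lat" for y
      using that by (auto simp: lat_def intro!: int_vec_inner_lattice_pts)
    have "?h i (int_vec (a i), 0) \<noteq> 0"
      using normal_nonzero[OF rep \<open>i < m\<close>] by (simp add: int_vec_eq_0_iff)
    then show "\<exists>y. ?h i y \<noteq> 0" by blast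
  qed
  have hs: "linear g \<and> (\<forall>y\<in>lat. g y \<in> \<int>) \<and> (\<exists>y. g y \<noteq> 0)" if g_in: "g \<in> set (map ?h [0..<m])" for g
  proof -
    obtain i where i: "i < m" and g: "g = ?h i" using g_in by auto
    show ?thesis unfolding g using i by (rule h)
  qed
  \<comment> \<open>The type \<open>'d option\<close> indexes the d + 1 generators, so the exponent
    becomes \<open>CARD('d)\<close>.\<close>
  have "reciprocal (CARD('d option) - 1) (\<lambda>t. card (cone_pts c (map ?h [0..<m]) (v, 0) t))
    (\<lambda>t. card (cone_pts c (map ?h [0..<m]) (- (v, 0)) t))"
    using cone gen _ hs by (rule reciprocal_cut_simplicial_cone) simp
  then have "reciprocal CARD('d) (\<lambda>t. card (cone_pts c (map ?h [0..<m]) (v, 0) t))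
    (\<lambda>t. card (cone_pts c (map ?h [0..<m]) (- v, 0) t))"
    by simp
  then show ?thesis
  proof (rule reciprocal_cong)
    fix t :: int assume t: "t \<ge> 1"
    show "TL P v (of_int t) = card (cone_pts c (map ?h [0..<m]) (v, 0) t)"
      using P(1) t c v by (rule TL_eq_card_cone_pts)
    show "TL P (- v) (of_int t) = card (cone_pts c (map ?h [0..<m]) (- v, 0) t)"
      using P(1) t c v_minus by (rule TL_eq_card_cone_pts)
  qed
qed

section \<open>From generic translations to open cells\<close>

text \<open>At an integer value floor and ceiling coincide, and both are constant on the cell; so
  the cell would lie in a hyperplane and have dimension below \<open>d\<close>.\<close>

lemma Delta_cell_full_dim_notin_Ints:
  fixes y :: "real^'d"
  assumes C: "C \<in> Delta_cells m a" "aff_dim C = int CARD('d)" and y: "y \<in> C"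
    and i: "i < m" "a i \<noteq> 0"
  shows "int_vec (a i) \<bullet> y \<notin> \<int>"
proof
  assume "int_vec (a i) \<bullet> y \<in> \<int>"
  then obtain r where r: "int_vec (a i) \<bullet> y = of_int r" by (rule Ints_cases)
  obtain x where C_eq: "C = Delta_cell m a x"
    using C(1) by (auto simp: Delta_cells_def)
  have "C \<subseteq> {z. int_vec (a i) \<bullet> z = of_int r}"
  proof
    fix z assume "z \<in> C"
    then have "\<lfloor>int_vec (a i) \<bullet> z\<rfloor> = r" "\<lceil>int_vec (a i) \<bullet> z\<rceil> = r"
      using y i(1) r by (auto simp: C_eq Delta_cell_def)
    then show "z \<in> {z. int_vec (a i) \<bullet> z = of_int r}"
      using of_int_floor_le[of "int_vec (a i) \<bullet> z"] le_of_int_ceiling[of "int_vec (a i) \<bullet> z"] by simp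
  qed
  then have "aff_dim C \<le> aff_dim {z. int_vec (a i) \<bullet> z = of_int r}"
    by (rule aff_dim_subset)
  also have "\<dots> = int CARD('d) - 1"
    using i(2) by (simp add: aff_dim_hyperplane int_vec_eq_0_iff)
  finally show False using C(2) by simp
qed

text \<open>On the open set \<open>S\<close>, which contains \<open>v\<close>, the ceilings for
  \<open>y\<close> and for \<open>- y\<close> are constant simultaneously. A generic point of
  \<open>S\<close> can therefore replace \<open>v\<close> in both counts.\<close>

lemma reciprocal_TL:
  fixes P :: "(real^'d) set"
  assumes rep: "polytope_rep P m a b" and v: "\<And>i. i < m \<Longrightarrow> int_vec (a i) \<bullet> v \<notin> \<int>"
  shows "reciprocal CARD('d) (\<lambda>t. TL P v (of_int t)) (\<lambda>t. TL P (- v) (of_int t))"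
proof -
  have P: "P = ineq_set m a b"
    using rep by (simp add: polytope_rep_def)
  define S where "S = (\<Inter>i<m. {y. of_int \<lfloor>int_vec (a i) \<bullet> v\<rfloor> < int_vec (a i) \<bullet> y} \<inter>
      {y. int_vec (a i) \<bullet> y < of_int (\<lfloor>int_vec (a i) \<bullet> v\<rfloor> + 1)})"
  have "open S"
    unfolding S_def by (intro open_INT open_Int ballI open_halfspace_gt open_halfspace_lt) auto
  moreover have "v \<in> S"
  proof -
    have "of_int \<lfloor>int_vec (a i) \<bullet> v\<rfloor> < int_vec (a i) \<bullet> v" if "i < m" for i
      using v[OF that] of_int_floor_le[of "int_vec (a i) \<bullet> v"] by (metis Ints_of_int order_le_less)
    then show ?thesis
      unfolding S_def by (auto simp: floor_less_iff[symmetric])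
  qed
  ultimately obtain v' where v': "v' \<in> S" "generic v'"
    using generic_dense by blast
  have ceil: "\<lceil>int_vec (a i) \<bullet> y\<rceil> = \<lfloor>int_vec (a i) \<bullet> v\<rfloor> + 1" "\<lceil>int_vec (a i) \<bullet> (- y)\<rceil> = - \<lfloor>int_vec (a i) \<bullet> v\<rfloor>"
    if "y \<in> S" "i < m" for y i
  proof -
    have "of_int \<lfloor>int_vec (a i) \<bullet> v\<rfloor> < int_vec (a i) \<bullet> y" "int_vec (a i) \<bullet> y < of_int (\<lfloor>int_vec (a i) \<bullet> v\<rfloor> + 1)"
      using that by (auto simp: S_def)
    then show "\<lceil>int_vec (a i) \<bullet> y\<rceil> = \<lfloor>int_vec (a i) \<bullet> v\<rfloor> + 1"
      "\<lceil>int_vec (a i) \<bullet> (- y)\<rceil> = - \<lfloor>int_vec (a i) \<bullet> v\<rfloor>"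
      by (simp_all add: ceiling_eq_iff)
  qed
  show ?thesis
  proof (rule reciprocal_cong[OF reciprocal_TL_generic[OF rep v'(2)]])
    fix t :: int assume t: "t \<ge> 1"
    show "TL P v (of_int t) = TL P v' (of_int t)"
      by (rule TL_eq_if_ceiling_eq[OF P t]) (simp only: ceil[OF \<open>v \<in> S\<close>] ceil[OF v'(1)])
    show "TL P (- v) (of_int t) = TL P (- v') (of_int t)"
      by (rule TL_eq_if_ceiling_eq[OF P t]) (simp only: ceil[OF \<open>v \<in> S\<close>] ceil[OF v'(1)])
  qed
qed

section \<open>Comparison of constituents\<close>

lemma poly_eq_on_residue_class:
  fixes f g :: "real poly"
  assumes q: "q > 0" and eq: "\<And>t::int. t \<ge> 1 \<Longrightarrow> t mod q = k mod q \<Longrightarrow> poly f (of_int t) = poly g (of_int t)"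
  shows "f = g"
proof (rule ccontr)
  assume "f \<noteq> g"
  then have "finite {x. poly (f - g) x = 0}"
    by (intro poly_roots_finite) simp
  \<comment> \<open>The summand 1 in \<open>1 + int n\<close> keeps these arguments at least 1 even
    when \<open>k mod q = 0\<close>.\<close>
  moreover have "range (\<lambda>n::nat. real_of_int (k mod q + q * (1 + int n))) \<subseteq> {x. poly (f - g) x = 0}"
  proof clarify
    fix n :: nat
    have "0 \<le> k mod q" "1 * 1 \<le> q * (1 + int n)"
      using q by (simp, intro mult_mono) auto
    then have "k mod q + q * (1 + int n) \<ge> 1" by simp
    then show "poly (f - g) (real_of_int (k mod q + q * (1 + int n))) = 0"
      using eq[of "k mod q + q * (1 + int n)"] by simp
  qed
  moreover have "inj (\<lambda>n::nat. real_of_int (k mod q + q * (1 + int n)))"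
    using q by (auto intro: injI)
  ultimately show False
    using finite_subset range_inj_infinite by blast
qed

theorem mainTheorem9:
  fixes P :: "(real^'d) set" and m :: nat and a :: "nat \<Rightarrow> int^'d" and b :: "nat \<Rightarrow> int"
    and u :: "int^'d" and C :: "(real^'d) set" and z :: "int^'d" and v :: "real^'d"
    and k :: int and f g :: "real poly"
  assumes "polytope_rep P m a b"
    and "uminus ` P = (\<lambda>x. x + int_vec u) ` P"
    and "C \<in> Delta_cells m a" and "aff_dim C = int CARD('d)"
    and "v - int_vec z \<in> C"
    and "is_constituent (\<lambda>t. real (TL P v (of_int t))) k f"
    and "is_constituent (\<lambda>t. real (TL P v (of_int t))) (- k) g"
  shows "\<forall>t::real. poly f t = (-1) ^ CARD('d) * poly g (- t)"
proof -
  let ?n = "CARD('d)"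
  \<comment> \<open>Passing from the point of \<open>C\<close> to \<open>v\<close> adds an integer
    vector, which shifts each product with a normal by an integer.\<close>
  have "int_vec (a i) \<bullet> v \<notin> \<int>" if "i < m" for i
  proof
    assume "int_vec (a i) \<bullet> v \<in> \<int>"
    moreover have "int_vec (a i) \<bullet> int_vec z \<in> \<int>"
      by (rule int_vec_inner_lattice_pts) (simp add: lattice_pts_def int_vec_def)
    ultimately have "int_vec (a i) \<bullet> (v - int_vec z) \<in> \<int>"
      by (simp add: inner_diff_right)
    then show False
      using Delta_cell_full_dim_notin_Ints[OF assms(3-5) that normal_nonzero[OF assms(1) that]] by blast
  qed
  \<comment> \<open>The central symmetry of \<open>P\<close> replaces the count for
    \<open>- v\<close> by the one for \<open>v\<close>, so \<open>F\<close> is reciprocal to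
    itself.\<close>
  from reciprocal_TL[OF assms(1) this] obtain F where F: "quasi_poly F"
    and pos: "\<And>t. t \<ge> 1 \<Longrightarrow> F t = real (TL P v (of_int t))"
    and neg: "\<And>t. t \<ge> 1 \<Longrightarrow> F (- t) = (-1) ^ ?n * real (TL P v (of_int t))"
    unfolding reciprocal_def TL_uminus[OF assms(2)] by blast
  obtain D p where D: "D > 0" and p: "\<And>t. t mod D = k mod D \<Longrightarrow> F t = poly p (of_int t)"
    using F unfolding quasi_poly_def by metis
  obtain q1 where q1: "q1 > 0"
    and f: "\<And>t. t \<ge> 1 \<Longrightarrow> t mod q1 = k mod q1 \<Longrightarrow> real (TL P v (of_int t)) = poly f (of_int t)"
    using assms(6) unfolding is_constituent_def by blast
  obtain q2 where q2: "q2 > 0"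
    and g: "\<And>t. t \<ge> 1 \<Longrightarrow> t mod q2 = - k mod q2 \<Longrightarrow> real (TL P v (of_int t)) = poly g (of_int t)"
    using assms(7) unfolding is_constituent_def by blast
  have residue: "t mod r = l mod r \<and> t mod s = l mod s" if "t mod (r * s) = l mod (r * s)" for t l r s :: int
    using that by (metis dvd_triv_left dvd_triv_right mod_mod_cancel)
  have "f = p"
  proof (rule poly_eq_on_residue_class)
    show "D * q1 > 0" using D q1 by simp
    show "poly f (of_int t) = poly p (of_int t)" if "t \<ge> 1" "t mod (D * q1) = k mod (D * q1)" for t
      using f[of t] p[of t] pos[of t] that residue[OF that(2)] by simp
  qed
  \<comment> \<open>If \<open>t\<close> is congruent to \<open>- k\<close>, then \<open>- t\<close>
    is congruent to \<open>k\<close>, so \<open>g\<close> is compared with the same piece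
    \<open>p\<close> that equals \<open>f\<close>.\<close>
  moreover have "g = smult ((-1) ^ ?n) (pcompose p [:0, -1:])"
  proof (rule poly_eq_on_residue_class)
    show "D * q2 > 0" using D q2 by simp
    fix t :: int assume t: "t \<ge> 1" "t mod (D * q2) = - k mod (D * q2)"
    have "(- t) mod D = k mod D"
      using residue[OF t(2)] mod_minus_cong[of t D "- k"] by simp
    then have "poly p (- of_int t) = (-1) ^ ?n * real (TL P v (of_int t))"
      using p[of "- t"] neg[of t] t(1) by simp
    moreover have "real (TL P v (of_int t)) = poly g (of_int t)"
      using g t residue[OF t(2)] by blast
    ultimately show "poly g (of_int t) = poly (smult ((-1) ^ ?n) (pcompose p [:0, -1:])) (of_int t)"
      by (simp add: poly_pcompose power_mult_distrib[symmetric] flip: mult.assoc)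
  qed
  ultimately show ?thesis
    by (simp add: poly_pcompose flip: mult.assoc power_mult_distrib)
qed

end
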